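(* Let $X$ be a compact Hausdorff space with a fixed base point and let $A$ be a unital C*-algebra. Then $$gsr(C(\Sigma X)\otimes A) = \max\{gsr(A), \mathrm{inj}_X(A)\},$$ where $\Sigma X$ is the reduced suspension of $X$ and $\mathrm{inj}_X(A)$ denotes the least $n\geq 1$ such that the map $[X,GL_{m-1}(A)]_{\ast}\to [X,GL_m(A)]_{\ast}$ induced by $a\mapsto \begin{pmatrix} a & 0\\ 0& 1\end{pmatrix}$ is injective for all $m\geq n$.
   Context: For a unital C*-algebra $A$ and $n\ge 1$, $Lg_n(A)$ is the set of left unimodular vectors, i.e. $(a_1,\dots,a_n)\in A^n$ with $Aa_1+\dots+Aa_n=A$. $GL_n(A)$ is the group of invertible elements of $M_n(A)$ with base point the identity $I_n$ (and $GL_0(A)=\{1\}$), acting on $Lg_n(A)$ by left multiplication. The general stable rank $gsr(A)$ is the least $n\ge 1$ such that $GL_m(A)$ acts transitively on $Lg_m(A)$ for all $m\ge n$ (equivalently: for all $m\ge n$, every projective right $A$-module $P$ with $P\oplus A\cong A^m$ satisfies $P\cong A^{m-1}$). Quantities defined as a least $n$ are $+\infty$ if no such $n$ exists. $[X,Y]_{\ast}$ is the set of based homotopy classes of based continuous maps. With base point $x_0\in X$ and $\mathbb{I}=[0,1]$, the reduced suspension is $\Sigma X=(\mathbb{I}\times X)/\sim$ where $(0,x)\sim(0,x_0)$, $(1,x)\sim(1,x_0)$, $(s,x_0)\sim(0,x_0)$ for all $x\in X$, $s\in\mathbb{I}$. *)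

theory Defs
  imports "HOL-Analysis.Analysis" "HOL-Library.Extended_Nat"
begin

section \<open>Unital C*-algebras\<close>

text \<open>The norm and completeness come from the library classes; \<open>norm 1 = 1\<close> (for \<open>1 \<noteq> 0\<close>) follows
  from the C*-identity and is not assumed. Neither is \<open>0 \<noteq> 1\<close>: the zero algebra is an instance,
  which is why the class extends \<open>real_normed_algebra\<close> and \<open>monoid_mult\<close> rather than
  \<open>real_normed_algebra_1\<close>.\<close>

class unital_cstar_algebra = real_normed_algebra + banach + monoid_mult +
  fixes scaleC :: "complex \<Rightarrow> 'a \<Rightarrow> 'a" (infixr \<open>*\<^sub>C\<close> 75)
    and cstar :: "'a \<Rightarrow> 'a"
  assumes scaleC_of_real: "of_real r *\<^sub>C x = r *\<^sub>R x"
    and scaleC_add_right: "c *\<^sub>C (x + y) = c *\<^sub>C x + c *\<^sub>C y"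
    and scaleC_add_left: "(c + d) *\<^sub>C x = c *\<^sub>C x + d *\<^sub>C x"
    and scaleC_scaleC: "c *\<^sub>C d *\<^sub>C x = (c * d) *\<^sub>C x"
    and scaleC_mult_left: "(c *\<^sub>C x) * y = c *\<^sub>C (x * y)"
    and scaleC_mult_right: "x * (c *\<^sub>C y) = c *\<^sub>C (x * y)"
    and norm_scaleC: "norm (c *\<^sub>C x) = cmod c * norm x"
    and cstar_add: "cstar (x + y) = cstar x + cstar y"
    and cstar_scaleC: "cstar (c *\<^sub>C x) = cnj c *\<^sub>C cstar x"
    and cstar_mult: "cstar (x * y) = cstar y * cstar x"
    and cstar_cstar: "cstar (cstar x) = x"
    and cstar_identity: "norm (cstar x * x) = (norm x)\<^sup>2"

instantiation complex :: unital_cstar_algebra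
begin
definition scaleC_complex :: "complex \<Rightarrow> complex \<Rightarrow> complex" where "scaleC_complex = (*)"
definition cstar_complex :: "complex \<Rightarrow> complex" where "cstar_complex = cnj"
instance
  by standard
    (auto simp: scaleC_complex_def cstar_complex_def scaleR_conv_of_real algebra_simps norm_mult
      power2_eq_square)
end


section \<open>General linear groups and the general stable rank\<close>

text \<open>An \<open>m \<times> m\<close> matrix is a function of two indices that vanishes unless both are less than \<open>m\<close>;
  a vector of length \<open>m\<close> vanishes at indices \<open>\<ge> m\<close>. In particular there is exactly one
  \<open>0 \<times> 0\<close> matrix. The notions are relative to a unital subring \<open>S\<close> of a ring, with the same unit;
  for a whole algebra \<open>S = UNIV\<close>.\<close>

definition mats :: "'a::zero set \<Rightarrow> nat \<Rightarrow> (nat \<Rightarrow> nat \<Rightarrow> 'a) set" where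
  "mats S m = {a. (\<forall>i<m. \<forall>j<m. a i j \<in> S) \<and> (\<forall>i j. \<not> (i < m \<and> j < m) \<longrightarrow> a i j = 0)}"

definition vecs :: "'a::zero set \<Rightarrow> nat \<Rightarrow> (nat \<Rightarrow> 'a) set" where
  "vecs S m = {v. (\<forall>i<m. v i \<in> S) \<and> (\<forall>i\<ge>m. v i = 0)}"

definition mat_mult ::
    "nat \<Rightarrow> (nat \<Rightarrow> nat \<Rightarrow> 'a::semiring_0) \<Rightarrow> (nat \<Rightarrow> nat \<Rightarrow> 'a) \<Rightarrow> (nat \<Rightarrow> nat \<Rightarrow> 'a)" where
  "mat_mult m a b = (\<lambda>i j. \<Sum>k<m. a i k * b k j)"

definition mat_vec :: "nat \<Rightarrow> (nat \<Rightarrow> nat \<Rightarrow> 'a::semiring_0) \<Rightarrow> (nat \<Rightarrow> 'a) \<Rightarrow> (nat \<Rightarrow> 'a)" where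
  "mat_vec m a v = (\<lambda>i. \<Sum>k<m. a i k * v k)"

definition id_mat :: "nat \<Rightarrow> nat \<Rightarrow> nat \<Rightarrow> 'a::{zero,one}" where
  "id_mat m = (\<lambda>i j. if i < m \<and> i = j then 1 else 0)"

definition GL :: "'a::{ring,monoid_mult} set \<Rightarrow> nat \<Rightarrow> (nat \<Rightarrow> nat \<Rightarrow> 'a) set" where
  "GL S m = {a \<in> mats S m. \<exists>b\<in>mats S m. mat_mult m a b = id_mat m \<and> mat_mult m b a = id_mat m}"

definition Lg :: "'a::{ring,monoid_mult} set \<Rightarrow> nat \<Rightarrow> (nat \<Rightarrow> 'a) set" where
  "Lg S m = {v \<in> vecs S m. {\<Sum>i<m. b i * v i | b. b \<in> vecs S m} = S}"

definition gsr :: "'a::{ring,monoid_mult} set \<Rightarrow> enat" where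
  "gsr S = Inf {enat n | n. n \<ge> 1 \<and>
     (\<forall>m\<ge>n. \<forall>v\<in>Lg S m. \<forall>w\<in>Lg S m. \<exists>g\<in>GL S m. mat_vec m g v = w)}"


section \<open>Based homotopy classes and the injectivity rank\<close>

definition based_maps :: "'x topology \<Rightarrow> 'x \<Rightarrow> 'y topology \<Rightarrow> 'y \<Rightarrow> ('x \<Rightarrow> 'y) set" where
  "based_maps X x0 Y y0 = {f. continuous_map X Y f \<and> f x0 = y0}"

definition based_homotopy_rel ::
    "'x topology \<Rightarrow> 'x \<Rightarrow> 'y topology \<Rightarrow> 'y \<Rightarrow> (('x \<Rightarrow> 'y) \<times> ('x \<Rightarrow> 'y)) set" where
  "based_homotopy_rel X x0 Y y0 =
     {(f, g). f \<in> based_maps X x0 Y y0 \<and> g \<in> based_maps X x0 Y y0 \<and>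
              homotopic_with (\<lambda>h. h x0 = y0) X Y f g}"

definition based_classes :: "'x topology \<Rightarrow> 'x \<Rightarrow> 'y topology \<Rightarrow> 'y \<Rightarrow> ('x \<Rightarrow> 'y) set set" where
  "based_classes X x0 Y y0 = based_maps X x0 Y y0 // based_homotopy_rel X x0 Y y0"

class pointed_topological_space = topological_space +
  fixes basepoint :: 'a

text \<open>\<open>nat \<Rightarrow> nat \<Rightarrow> 'a\<close> carries the product topology, so \<open>GL_top m\<close> is the topology of entrywise
  convergence, which is the norm topology of the C*-algebra \<open>M\<^sub>m(A)\<close>.\<close>

definition GL_top :: "nat \<Rightarrow> (nat \<Rightarrow> nat \<Rightarrow> 'a::unital_cstar_algebra) topology" where
  "GL_top m = top_of_set (GL UNIV m)"

definition GL_classes ::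
    "nat \<Rightarrow> ('x::pointed_topological_space \<Rightarrow> nat \<Rightarrow> nat \<Rightarrow> 'a::unital_cstar_algebra) set set" where
  "GL_classes m = based_classes euclidean basepoint (GL_top m) (id_mat m)"

text \<open>On \<open>k \<times> k\<close> matrices, which vanish outside their index range, this is
  \<open>a \<mapsto> diag(a, 1)\<close>.\<close>

definition stab :: "nat \<Rightarrow> (nat \<Rightarrow> nat \<Rightarrow> 'a::{zero,one}) \<Rightarrow> (nat \<Rightarrow> nat \<Rightarrow> 'a)" where
  "stab k a = (\<lambda>i j. if i = k \<and> j = k then 1 else a i j)"

text \<open>The map induced by \<open>stab k\<close> from the based classes of maps into \<open>GL\<^sub>k(A)\<close> to those of maps
  into \<open>GL\<^sub>k\<^sub>+\<^sub>1(A)\<close>, on equivalence classes.\<close>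

definition stab_classes ::
    "nat \<Rightarrow> ('x::pointed_topological_space \<Rightarrow> nat \<Rightarrow> nat \<Rightarrow> 'a::unital_cstar_algebra) set
      \<Rightarrow> ('x \<Rightarrow> nat \<Rightarrow> nat \<Rightarrow> 'a) set" where
  "stab_classes k c =
     based_homotopy_rel euclidean basepoint (GL_top (Suc k)) (id_mat (Suc k)) `` ((\<lambda>f. stab k \<circ> f) ` c)"

definition inj_rank ::
    "'x::pointed_topological_space itself \<Rightarrow> 'a::unital_cstar_algebra itself \<Rightarrow> enat" where
  "inj_rank X A = Inf {enat n | n. n \<ge> 1 \<and>
     (\<forall>m\<ge>n. inj_on (stab_classes (m - 1))
              (GL_classes (m - 1) :: ('x \<Rightarrow> nat \<Rightarrow> nat \<Rightarrow> 'a) set set))}"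


section \<open>The reduced suspension\<close>

inductive susp_glue :: "real \<times> 'x::pointed_topological_space \<Rightarrow> real \<times> 'x \<Rightarrow> bool" where
  "susp_glue (0, x) (0, basepoint)"
| "susp_glue (1, x) (1, basepoint)"
| "s \<in> {0..1} \<Longrightarrow> susp_glue (s, basepoint) (0, basepoint)"

text \<open>Restricted to \<open>[0,1] \<times> X\<close>, which thereby is the domain of the (partial) quotient.\<close>

definition susp_rel :: "real \<times> 'x::pointed_topological_space \<Rightarrow> real \<times> 'x \<Rightarrow> bool" where
  "susp_rel p q \<longleftrightarrow> p \<in> {0..1} \<times> UNIV \<and> q \<in> {0..1} \<times> UNIV \<and> equivclp susp_glue p q"

quotient_type (overloaded) 'x susp = "real \<times> 'x::pointed_topological_space" / partial: susp_rel
proof (rule part_equivpI)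
  show "\<exists>p :: real \<times> 'x. susp_rel p p"
    by (rule exI[of _ "(0, basepoint)"]) (simp add: susp_rel_def)
  show "symp (susp_rel :: real \<times> 'x \<Rightarrow> _)"
    by (auto simp: susp_rel_def intro!: sympI intro: equivclp_sym)
  show "transp (susp_rel :: real \<times> 'x \<Rightarrow> _)"
    by (auto simp: susp_rel_def intro!: transpI intro: equivclp_trans)
qed

instantiation susp :: (pointed_topological_space) topological_space
begin

definition open_susp :: "'a susp set \<Rightarrow> bool" where
  "open_susp U \<longleftrightarrow>
     openin (top_of_set ({0..1} \<times> UNIV)) {p \<in> {0..1} \<times> UNIV. abs_susp p \<in> U}"

instance
proof
  show "open (UNIV :: 'a susp set)"
    by (simp add: open_susp_def)
next
  fix U V :: "'a susp set"
  assume "open U" "open V"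
  moreover have "{p \<in> {0..1} \<times> UNIV. abs_susp p \<in> U \<inter> V} =
      {p \<in> {0..1} \<times> UNIV. abs_susp p \<in> U} \<inter> {p \<in> {0..1} \<times> UNIV. abs_susp p \<in> V}"
    by auto
  ultimately show "open (U \<inter> V)"
    unfolding open_susp_def by (simp only: openin_Int)
next
  fix K :: "'a susp set set"
  assume *: "\<forall>U\<in>K. open U"
  have "{p \<in> {0..1} \<times> UNIV. abs_susp p \<in> \<Union>K} =
      \<Union> ((\<lambda>U. {p \<in> {0..1} \<times> UNIV. abs_susp p \<in> U}) ` K)"
    by auto
  then show "open (\<Union>K)"
    using * unfolding open_susp_def by (auto intro!: openin_Union)
qed

end

lemma continuous_on_abs_susp: "continuous_on ({0..1} \<times> UNIV) abs_susp"
  unfolding continuous_on_open_invariant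
proof (intro allI impI)
  fix U :: "'a susp set"
  assume "open U"
  then have "openin (top_of_set ({0..1} \<times> UNIV)) {p \<in> {0..1} \<times> UNIV. abs_susp p \<in> U}"
    by (simp only: open_susp_def)
  then obtain T where "open T" "{p \<in> {0..1} \<times> UNIV. abs_susp p \<in> U} = {0..1} \<times> UNIV \<inter> T"
    unfolding openin_open by blast
  then show "\<exists>T. open T \<and> T \<inter> {0..1} \<times> UNIV = abs_susp -` U \<inter> {0..1} \<times> UNIV"
    by (intro exI[of _ T]) blast
qed

lemma abs_susp_surj: "abs_susp ` ({0..1} \<times> UNIV) = UNIV"
proof -
  have "\<exists>q\<in>{0..1} \<times> UNIV. s = abs_susp q" for s :: "'a susp"
  proof -
    have "susp_rel (rep_susp s) (rep_susp s)" and "abs_susp (rep_susp s) = s"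
      using Quotient3_rep_reflp[OF Quotient3_susp] Quotient3_abs_rep[OF Quotient3_susp] by auto
    then show ?thesis
      by (metis susp_rel_def)
  qed
  then show ?thesis
    by blast
qed

text \<open>Hence for compact \<open>X\<close> every continuous function on the suspension is bounded.\<close>

lemma compact_susp:
  assumes "compact (UNIV :: 'x::pointed_topological_space set)"
  shows "compact (UNIV :: 'x susp set)"
  using compact_continuous_image[OF continuous_on_abs_susp compact_Times[OF compact_Icc assms]]
  by (simp add: abs_susp_surj)


section \<open>The C*-tensor product with a commutative C*-algebra\<close>

instantiation bcontfun :: (topological_space, "{real_normed_algebra,monoid_mult}")
  "{real_normed_algebra,monoid_mult}"
begin

context includes bcontfun.lifting begin

lift_definition times_bcontfun :: "('a \<Rightarrow>\<^sub>C 'b) \<Rightarrow> ('a \<Rightarrow>\<^sub>C 'b) \<Rightarrow> 'a \<Rightarrow>\<^sub>C 'b" is "\<lambda>f g x. f x * g x"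
proof -
  fix f g :: "'a \<Rightarrow> 'b"
  assume f: "f \<in> bcontfun" and g: "g \<in> bcontfun"
  obtain B C where B: "\<And>x. norm (f x) \<le> B" and C: "\<And>x. norm (g x) \<le> C"
    using f g by (auto simp: bcontfun_def bounded_iff)
  have "norm (f x * g x) \<le> B * C" for x
    using norm_mult_ineq[of "f x" "g x"] mult_mono[OF B[of x] C[of x]] B[of x]
    by (smt (verit) norm_ge_zero)
  moreover have "continuous_on UNIV (\<lambda>x. f x * g x)"
    using f g by (auto simp: bcontfun_def intro!: continuous_intros)
  ultimately show "(\<lambda>x. f x * g x) \<in> bcontfun"
    by (rule bcontfun_normI[rotated])
qed

lift_definition one_bcontfun :: "'a \<Rightarrow>\<^sub>C 'b" is "\<lambda>_. 1"
  by (rule const_bcontfun)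

end

lemmas [simp] = times_bcontfun.rep_eq one_bcontfun.rep_eq

instance
proof
  fix f g :: "'a \<Rightarrow>\<^sub>C 'b"
  show "norm (f * g) \<le> norm f * norm g"
  proof (rule norm_bound)
    fix x
    have "norm (f x * g x) \<le> norm (f x) * norm (g x)"
      by (rule norm_mult_ineq)
    also have "\<dots> \<le> norm f * norm g"
      by (intro mult_mono norm_bounded norm_ge_zero)
    finally show "norm ((f * g) x) \<le> norm f * norm g"
      by simp
  qed
qed (auto intro!: bcontfun_eqI simp: algebra_simps)

end

definition elem_tensor ::
    "('y::topological_space \<Rightarrow>\<^sub>C complex) \<Rightarrow> 'a::unital_cstar_algebra \<Rightarrow> ('y \<Rightarrow>\<^sub>C 'a)" where
  "elem_tensor f a = Bcontfun (\<lambda>y. f y *\<^sub>C a)"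

lemma apply_elem_tensor [simp]: "apply_bcontfun (elem_tensor f a) y = f y *\<^sub>C a"
proof -
  have "bounded_linear (\<lambda>c. c *\<^sub>C a)"
    by (rule bounded_linear_intro[where K = "norm a"])
      (simp_all add: scaleC_add_left norm_scaleC scaleR_conv_of_real flip: scaleC_scaleC scaleC_of_real)
  then have "continuous_on UNIV (\<lambda>y. f y *\<^sub>C a)"
    by (rule bounded_linear.continuous_on) simp
  moreover have "norm (f y *\<^sub>C a) \<le> norm f * norm a" for y
    using norm_bounded[of f y] by (simp add: norm_scaleC mult_right_mono)
  ultimately have "(\<lambda>y. f y *\<^sub>C a) \<in> bcontfun"
    by (rule bcontfun_normI)
  then show ?thesis
    by (simp add: elem_tensor_def Bcontfun_inverse)
qed

text \<open>For compact \<open>Y\<close>, the C*-algebra \<open>C(Y) \<otimes> A\<close>: the completion of the algebraic tensor product,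
  realised as the closed linear span of the elementary tensors inside the algebra of bounded
  continuous functions \<open>Y \<Rightarrow> A\<close> with the supremum norm. Representing \<open>C(Y)\<close> by multiplication
  operators on \<open>\<ell>\<^sup>2(Y)\<close> shows that the supremum norm is the spatial tensor norm, which is the only
  C*-norm on the algebraic tensor product because \<open>C(Y)\<close> is nuclear. The real span of the elementary
  tensors is already their complex span, since \<open>c(f \<otimes> a) = (cf) \<otimes> a\<close>.\<close>

definition C_tensor :: "('y::topological_space \<Rightarrow>\<^sub>C 'a::unital_cstar_algebra) set" where
  "C_tensor = closure (span {elem_tensor f a | f a. True})"

end

(* The equality holds degree by degree: for m = k + 1, GL_m acts transitively on the left unimodular
   vectors over B = C(SX) \<otimes> A if and only if it does so over A and stabilisation from GL_k to GL_m
   is injective on based homotopy classes. Elements of B are the functions on [0,1] \<times> X that are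
   constant on the part collapsed to the base point, and all of GL_m(A) acts transitively as soon as
   the orbit of the last unit vector e_k is everything. A vector over B is thus a loop of unimodular
   vectors over A with parameters in X; lifting it to a path in GL_m(A) starting at the identity, the
   end of the path fixes e_k and is, up to homotopy, a stabilised map X \<rightarrow> GL_k(A). The lift
   can be closed up exactly when that map is null-homotopic in GL_k(A). *)
theory Submission
  imports Defs
begin

section \<open>Matrices over a ring\<close>

text \<open>Paths are lifted by transvections: if \<open>b v = 1\<close> and \<open>w\<close> is
  close to \<open>v\<close>, then \<open>I + (w - v) b\<close> carries \<open>v\<close> to
  \<open>w\<close>, and it is invertible because \<open>b w\<close> is close to 1. Compactness of X
  lets one step length serve all x at once. Two corrections turn a lift into a based homotopy ending
  in stabilised matrices. The lift need not be the identity over the base point, but there it fixes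
  e_k, so dividing by its value over the base point keeps the last column. And fixing e_k prescribes
  the last column alone: the stabiliser of e_k consists of the block matrices (a 0; r 1), from which
  the row r is removed by shrinking it to 0. The two directions are not mirror images. Given
  transitivity over B, an arbitrary pair of maps that become homotopic is treated directly. For the
  converse, injectivity is applied with the constant map as one of the two, and transitivity over A
  moves the value at the base point to e_k beforehand.\<close>

lemma mats_mult [intro]: "a \<in> mats UNIV m \<Longrightarrow> b \<in> mats UNIV m \<Longrightarrow> mat_mult m a b \<in> mats UNIV m"
  by (auto simp: mats_def mat_mult_def intro!: sum.neutral)

lemma mats_eqI:
  assumes "a \<in> mats S m" "b \<in> mats T m" "\<And>i j. i < m \<Longrightarrow> j < m \<Longrightarrow> a i j = b i j"
  shows "a = b"
  using assms unfolding mats_def by (intro ext) (metis (mono_tags, lifting) mem_Collect_eq)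

lemma vecs_eqI:
  assumes "v \<in> vecs S m" "w \<in> vecs T m" "\<And>i. i < m \<Longrightarrow> v i = w i"
  shows "v = w"
  using assms unfolding vecs_def by (intro ext) (metis (mono_tags, lifting) mem_Collect_eq not_le)

lemma mats_id [intro, simp]: "id_mat m \<in> mats UNIV m"
  by (auto simp: mats_def id_mat_def)

lemma vecs_mat_vec [intro]: "a \<in> mats UNIV m \<Longrightarrow> mat_vec m a v \<in> vecs UNIV m"
  by (auto simp: mats_def vecs_def mat_vec_def intro!: sum.neutral)

lemma mat_mult_assoc: "mat_mult m (mat_mult m a b) c = mat_mult m a (mat_mult m b c)"
proof (intro ext)
  fix i j
  have "(\<Sum>k<m. (\<Sum>l<m. a i l * b l k) * c k j) = (\<Sum>k<m. \<Sum>l<m. a i l * (b l k * c k j))"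
    by (simp add: sum_distrib_right mult.assoc)
  also have "\<dots> = (\<Sum>l<m. a i l * (\<Sum>k<m. b l k * c k j))"
    by (subst sum.swap) (simp add: sum_distrib_left)
  finally show "mat_mult m (mat_mult m a b) c i j = mat_mult m a (mat_mult m b c) i j"
    by (simp add: mat_mult_def)
qed

lemma mat_vec_mult: "mat_vec m (mat_mult m a b) v = mat_vec m a (mat_vec m b v)"
proof
  fix i
  have "(\<Sum>k<m. (\<Sum>l<m. a i l * b l k) * v k) = (\<Sum>k<m. \<Sum>l<m. a i l * (b l k * v k))"
    by (simp add: sum_distrib_right mult.assoc)
  also have "\<dots> = (\<Sum>l<m. a i l * (\<Sum>k<m. b l k * v k))"
    by (subst sum.swap) (simp add: sum_distrib_left)
  finally show "mat_vec m (mat_mult m a b) v i = mat_vec m a (mat_vec m b v) i"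
    by (simp add: mat_mult_def mat_vec_def)
qed

lemma sum_delta_mult:
  fixes f :: "nat \<Rightarrow> 'a::{ring,monoid_mult}"
  shows "(\<Sum>k<m. (if i = k then 1 else 0) * f k) = (if i < m then f i else 0)"
    and "(\<Sum>k<m. f k * (if k = i then 1 else 0)) = (if i < m then f i else 0)"
proof -
  have "(if i = k then 1 else 0) * f k = (if i = k then f k else 0)" for k by simp
  then show "(\<Sum>k<m. (if i = k then 1 else 0) * f k) = (if i < m then f i else 0)"
    by (simp add: sum.delta')
  have "f k * (if k = i then 1 else 0) = (if k = i then f k else 0)" for k by simp
  then show "(\<Sum>k<m. f k * (if k = i then 1 else 0)) = (if i < m then f i else 0)"
    by simp
qed

lemma mat_mult_id_left [simp]:
  fixes a :: "nat \<Rightarrow> nat \<Rightarrow> 'a::{ring,monoid_mult}"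
  assumes "a \<in> mats UNIV m"
  shows "mat_mult m (id_mat m) a = a"
proof (rule mats_eqI)
  fix i j assume "i < m" "j < m"
  then show "mat_mult m (id_mat m) a i j = a i j"
    by (simp add: mat_mult_def id_mat_def sum_delta_mult)
qed (use assms in auto)

lemma mat_mult_id_right [simp]:
  fixes a :: "nat \<Rightarrow> nat \<Rightarrow> 'a::{ring,monoid_mult}"
  assumes "a \<in> mats UNIV m"
  shows "mat_mult m a (id_mat m) = a"
proof (rule mats_eqI)
  fix i j assume ij: "i < m" "j < m"
  have "(\<Sum>k<m. a i k * id_mat m k j) = (\<Sum>k<m. a i k * (if k = j then 1 else 0))"
    by (intro sum.cong) (auto simp: id_mat_def)
  then show "mat_mult m a (id_mat m) i j = a i j"
    using ij by (simp add: mat_mult_def sum_delta_mult)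
qed (use assms in auto)

lemma mat_vec_id [simp]:
  fixes v :: "nat \<Rightarrow> 'a::{ring,monoid_mult}"
  assumes "v \<in> vecs UNIV m"
  shows "mat_vec m (id_mat m) v = v"
proof (rule vecs_eqI)
  fix i assume "i < m"
  then show "mat_vec m (id_mat m) v i = v i"
    by (simp add: mat_vec_def id_mat_def sum_delta_mult)
qed (use assms in auto)

text \<open>Meaningful on \<open>GL UNIV m\<close> only; a total function lets the pointwise inverse
  of a matrix-valued map be written as a map.\<close>

definition minv :: "nat \<Rightarrow> (nat \<Rightarrow> nat \<Rightarrow> 'a::{ring,monoid_mult}) \<Rightarrow> (nat \<Rightarrow> nat \<Rightarrow> 'a)" where
  "minv m a = (SOME b. b \<in> mats UNIV m \<and> mat_mult m a b = id_mat m \<and> mat_mult m b a = id_mat m)"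

lemma GL_mats: "a \<in> GL UNIV m \<Longrightarrow> a \<in> mats UNIV m"
  by (simp add: GL_def)

lemma GL_I:
  "a \<in> mats UNIV m \<Longrightarrow> b \<in> mats UNIV m \<Longrightarrow> mat_mult m a b = id_mat m \<Longrightarrow> mat_mult m b a = id_mat m
    \<Longrightarrow> a \<in> GL UNIV m"
  by (auto simp: GL_def)

lemma minv:
  assumes "a \<in> GL UNIV m"
  shows minv_mats: "minv m a \<in> mats UNIV m"
    and minv_right: "mat_mult m a (minv m a) = id_mat m"
    and minv_left: "mat_mult m (minv m a) a = id_mat m"
proof -
  have "\<exists>b. b \<in> mats UNIV m \<and> mat_mult m a b = id_mat m \<and> mat_mult m b a = id_mat m"
    using assms by (auto simp: GL_def)
  from someI_ex[OF this]
  show "minv m a \<in> mats UNIV m" "mat_mult m a (minv m a) = id_mat m"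
    "mat_mult m (minv m a) a = id_mat m"
    unfolding minv_def by auto
qed

lemma minv_GL: "a \<in> GL UNIV m \<Longrightarrow> minv m a \<in> GL UNIV m"
  by (meson GL_I GL_mats minv)

lemma id_mat_GL [simp]: "id_mat m \<in> GL UNIV m"
  by (rule GL_I[of _ _ "id_mat m"]) auto

lemma GL_mult:
  assumes "a \<in> GL UNIV m" "b \<in> GL UNIV m"
  shows "mat_mult m a b \<in> GL UNIV m"
proof (rule GL_I)
  note ab = GL_mats[OF assms(1)] GL_mats[OF assms(2)] minv[OF assms(1)] minv[OF assms(2)]
  show "mat_mult m a b \<in> mats UNIV m" "mat_mult m (minv m b) (minv m a) \<in> mats UNIV m"
    using ab by auto
  have "mat_mult m (mat_mult m a b) (mat_mult m (minv m b) (minv m a))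
      = mat_mult m a (mat_mult m (mat_mult m b (minv m b)) (minv m a))"
    by (simp only: mat_mult_assoc)
  then show "mat_mult m (mat_mult m a b) (mat_mult m (minv m b) (minv m a)) = id_mat m"
    using ab by simp
  have "mat_mult m (mat_mult m (minv m b) (minv m a)) (mat_mult m a b)
      = mat_mult m (minv m b) (mat_mult m (mat_mult m (minv m a) a) b)"
    by (simp only: mat_mult_assoc)
  then show "mat_mult m (mat_mult m (minv m b) (minv m a)) (mat_mult m a b) = id_mat m"
    using ab by simp
qed

lemma minv_eqI:
  assumes "a \<in> GL UNIV m" "b \<in> mats UNIV m" "mat_mult m a b = id_mat m"
  shows "minv m a = b"
  using assms minv[OF assms(1)] mat_mult_assoc[of m "minv m a" a b] by simp

lemma minv_id [simp]: "minv m (id_mat m) = id_mat m"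
  by (rule minv_eqI) auto

lemma mat_vec_minv:
  assumes "a \<in> GL UNIV m" "v \<in> vecs UNIV m"
  shows "mat_vec m (minv m a) (mat_vec m a v) = v"
  using assms minv_left[OF assms(1)] by (simp flip: mat_vec_mult)

lemma mat_vec_minv':
  assumes "a \<in> GL UNIV m" "v \<in> vecs UNIV m"
  shows "mat_vec m a (mat_vec m (minv m a) v) = v"
  using assms minv_right[OF assms(1)] by (simp flip: mat_vec_mult)

section \<open>Unimodular vectors and the orbit of a unit vector\<close>

definition unit_vec :: "nat \<Rightarrow> nat \<Rightarrow> 'a::{zero,one}" where
  "unit_vec k = (\<lambda>i. if i = k then 1 else 0)"

lemma unit_vec_vecs [simp]: "k < m \<Longrightarrow> unit_vec k \<in> vecs UNIV m"
  by (auto simp: unit_vec_def vecs_def)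

lemma mat_vec_unit:
  fixes a :: "nat \<Rightarrow> nat \<Rightarrow> 'a::{ring,monoid_mult}"
  shows "k < m \<Longrightarrow> mat_vec m a (unit_vec k) = (\<lambda>i. a i k)"
  by (simp add: mat_vec_def unit_vec_def sum_delta_mult)

text \<open>The combinations of the entries form a left ideal, which is everything once it contains
  1: multiply the coefficients of 1 by \<open>x\<close> from the left.\<close>

lemma Lg_iff:
  fixes v :: "nat \<Rightarrow> 'a::{ring,monoid_mult}"
  shows "v \<in> Lg UNIV m \<longleftrightarrow> v \<in> vecs UNIV m \<and> (\<exists>b\<in>vecs UNIV m. (\<Sum>i<m. b i * v i) = 1)"
proof (intro iffI conjI; (elim conjE bexE)?)
  assume v: "v \<in> Lg UNIV m"
  show "v \<in> vecs UNIV m" using v by (simp add: Lg_def)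
  have "1 \<in> {\<Sum>i<m. b i * v i | b. b \<in> vecs UNIV m}" using v by (auto simp: Lg_def)
  then show "\<exists>b\<in>vecs UNIV m. (\<Sum>i<m. b i * v i) = 1" by force
next
  fix b assume v: "v \<in> vecs UNIV m" and b: "b \<in> vecs UNIV m" "(\<Sum>i<m. b i * v i) = 1"
  have "x \<in> {\<Sum>i<m. b i * v i | b. b \<in> vecs UNIV m}" for x
  proof (intro CollectI exI conjI)
    show "(\<lambda>i. x * b i) \<in> vecs UNIV m" using b by (auto simp: vecs_def)
    show "x = (\<Sum>i<m. x * b i * v i)"
      using b(2) by (simp add: mult.assoc flip: sum_distrib_left)
  qed
  then show "v \<in> Lg UNIV m" using v by (auto simp: Lg_def)
qed

text \<open>The k-th row of the inverse supplies the coefficients: its product with the k-th column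
  is the (k, k) entry of the identity.\<close>

lemma Lg_column:
  fixes a :: "nat \<Rightarrow> nat \<Rightarrow> 'a::{ring,monoid_mult}"
  assumes "a \<in> GL UNIV m" "k < m"
  shows "mat_vec m a (unit_vec k) \<in> Lg UNIV m"
  unfolding Lg_iff
proof (intro conjI bexI)
  show "mat_vec m a (unit_vec k) \<in> vecs UNIV m" using assms GL_mats by blast
  show "minv m a k \<in> vecs UNIV m"
    using minv_mats[OF assms(1)] assms by (auto simp: vecs_def mats_def)
  have "(\<Sum>i<m. minv m a k i * a i k) = mat_mult m (minv m a) a k k" by (simp add: mat_mult_def)
  then show "(\<Sum>i<m. minv m a k i * mat_vec m a (unit_vec k) i) = 1"
    using assms by (simp add: mat_vec_unit minv_left id_mat_def)
qed

lemma unit_vec_Lg [simp]: "k < m \<Longrightarrow> (unit_vec k :: nat \<Rightarrow> 'a::{ring,monoid_mult}) \<in> Lg UNIV m"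
  using Lg_column[of "id_mat m" m k] by simp

lemma Lg_mat_vec:
  fixes v :: "nat \<Rightarrow> 'a::{ring,monoid_mult}"
  assumes "v \<in> Lg UNIV m" "g \<in> GL UNIV m"
  shows "mat_vec m g v \<in> Lg UNIV m"
proof -
  obtain b where v: "v \<in> vecs UNIV m" and b: "b \<in> vecs UNIV m" "(\<Sum>i<m. b i * v i) = 1"
    using assms(1) by (auto simp: Lg_iff)
  \<comment> \<open>If \<open>b v = 1\<close>, then the row \<open>b g^-1\<close> does the same for
    \<open>g v\<close>.\<close>
  let ?c = "\<lambda>j. \<Sum>i<m. b i * minv m g i j"
  have "?c \<in> vecs UNIV m"
    using minv_mats[OF assms(2)] by (auto simp: vecs_def mats_def intro!: sum.neutral)
  moreover have "(\<Sum>j<m. ?c j * mat_vec m g v j) = 1"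
  proof -
    have "(\<Sum>j<m. ?c j * mat_vec m g v j) = (\<Sum>j<m. \<Sum>i<m. b i * (minv m g i j * mat_vec m g v j))"
      by (simp add: sum_distrib_right mult.assoc)
    also have "\<dots> = (\<Sum>i<m. b i * mat_vec m (minv m g) (mat_vec m g v) i)"
      by (subst sum.swap) (simp add: sum_distrib_left mat_vec_def)
    finally show ?thesis using b v assms by (simp add: mat_vec_minv)
  qed
  ultimately show ?thesis using vecs_mat_vec[OF GL_mats[OF assms(2)]] by (auto simp: Lg_iff)
qed

definition GL_transitive :: "'a::{ring,monoid_mult} set \<Rightarrow> nat \<Rightarrow> bool" where
  "GL_transitive S m \<longleftrightarrow> (\<forall>v\<in>Lg S m. \<forall>w\<in>Lg S m. \<exists>g\<in>GL S m. mat_vec m g v = w)"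

lemma GL_transitive_iff:
  assumes "k < m"
  shows "GL_transitive (UNIV :: 'a::{ring,monoid_mult} set) m \<longleftrightarrow>
    (\<forall>v\<in>Lg (UNIV :: 'a set) m. \<exists>g\<in>GL UNIV m. mat_vec m g (unit_vec k) = v)" (is "?L \<longleftrightarrow> ?R")
proof
  show "?L \<Longrightarrow> ?R" using assms unit_vec_Lg unfolding GL_transitive_def by blast
  assume R: ?R
  show ?L unfolding GL_transitive_def
  proof (intro ballI)
    fix v w :: "nat \<Rightarrow> 'a" assume "v \<in> Lg UNIV m" "w \<in> Lg UNIV m"
    then obtain g h where g: "g \<in> GL UNIV m" "mat_vec m g (unit_vec k) = v"
      and h: "h \<in> GL UNIV m" "mat_vec m h (unit_vec k) = w" using R by meson
    have "mat_vec m (minv m g) v = unit_vec k"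
      using mat_vec_minv[OF g(1) unit_vec_vecs[OF assms]] g(2) by simp
    then have "mat_vec m (mat_mult m h (minv m g)) v = w" using h by (simp add: mat_vec_mult)
    then show "\<exists>g\<in>GL UNIV m. mat_vec m g v = w" using GL_mult[OF h(1) minv_GL[OF g(1)]] by blast
  qed
qed

section \<open>Transvections: perturbations of the identity by a column times a row\<close>

definition transvection ::
    "nat \<Rightarrow> (nat \<Rightarrow> 'a::{ring,monoid_mult}) \<Rightarrow> (nat \<Rightarrow> 'a) \<Rightarrow> (nat \<Rightarrow> nat \<Rightarrow> 'a)" where
  "transvection m u b = (\<lambda>i j. id_mat m i j + u i * b j)"

lemma transvection_mats:
  "u \<in> vecs UNIV m \<Longrightarrow> b \<in> vecs UNIV m \<Longrightarrow> transvection m u b \<in> mats UNIV m"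
  by (auto simp: transvection_def mats_def vecs_def id_mat_def not_less)

lemma mat_vec_transvection:
  assumes "w \<in> vecs UNIV m"
  shows "mat_vec m (transvection m u b) w = (\<lambda>i. w i + u i * (\<Sum>j<m. b j * w j))"
proof
  fix i
  have "mat_vec m (transvection m u b) w i = mat_vec m (id_mat m) w i + (\<Sum>j<m. u i * (b j * w j))"
    by (simp add: mat_vec_def transvection_def ring_distribs sum.distrib mult.assoc)
  then show "mat_vec m (transvection m u b) w i = w i + u i * (\<Sum>j<m. b j * w j)"
    using assms by (simp add: sum_distrib_left)
qed

text \<open>With a common row \<open>b\<close>, the product \<open>(I + u b)(I + u' b)\<close> is
  \<open>I + (u + u' + u (b u')) b\<close>, again of the same shape, since \<open>b u'\<close> is a
  single ring element.\<close>

lemma transvection_mult: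
  assumes u: "u \<in> vecs UNIV m" and u': "u' \<in> vecs UNIV m" and b: "b \<in> vecs UNIV m"
    and eq: "\<And>i. u i + u' i + u i * ((\<Sum>j<m. b j * u' j)) = 0"
  shows "mat_mult m (transvection m u b) (transvection m u' b) = id_mat m"
proof (rule mats_eqI)
  fix i j assume ij: "i < m" "j < m"
  \<comment> \<open>Column j of the second factor is the j-th unit vector plus \<open>u'\<close>
    times \<open>b j\<close>; the first factor is applied to the two summands separately.\<close>
  have "(\<lambda>k. id_mat m k j) \<in> vecs UNIV m" using ij by (auto simp: vecs_def id_mat_def)
  then have "mat_vec m (transvection m u b) (\<lambda>k. id_mat m k j) = (\<lambda>i. id_mat m i j + u i * b j)"
    using ij by (subst mat_vec_transvection) (auto simp: id_mat_def sum_delta_mult cong: sum.cong_simp)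
  moreover have "mat_mult m (transvection m u b) (transvection m u' b) i j
     = mat_vec m (transvection m u b) (\<lambda>k. id_mat m k j) i
       + mat_vec m (transvection m u b) u' i * b j"
    by (simp add: mat_mult_def mat_vec_def transvection_def[of m u'] ring_distribs sum.distrib
        sum_distrib_right mult.assoc)
  ultimately have "mat_mult m (transvection m u b) (transvection m u' b) i j
     = id_mat m i j + (u i + u' i + u i * ((\<Sum>j<m. b j * u' j))) * b j"
    using u' by (simp add: mat_vec_transvection ring_distribs)
  then show "mat_mult m (transvection m u b) (transvection m u' b) i j = id_mat m i j"
    by (simp only: eq) simp
qed (use assms in \<open>auto intro!: mats_mult transvection_mats\<close>)

lemma transvection_GL:
  assumes u: "u \<in> vecs UNIV m" and b: "b \<in> vecs UNIV m"
    and c: "(1 + (\<Sum>j<m. b j * u j)) * c = 1" "c * (1 + (\<Sum>j<m. b j * u j)) = 1"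
  shows "transvection m u b \<in> GL UNIV m"
proof (rule GL_I)
  \<comment> \<open>The inverse of \<open>I + u b\<close> is \<open>I - u c b\<close>, where
    \<open>c\<close> inverts the ring element \<open>1 + b u\<close>: the Sherman-Morrison formula
    over a noncommutative ring.\<close>
  let ?s = "\<Sum>j<m. b j * u j" and ?u = "\<lambda>i. - (u i * c)"
  have u': "?u \<in> vecs UNIV m" using u by (auto simp: vecs_def)
  show "transvection m u b \<in> mats UNIV m" "transvection m ?u b \<in> mats UNIV m"
    using u u' b by (auto intro: transvection_mats)
  have s: "(\<Sum>j<m. b j * ?u j) = - (?s * c)"
    by (simp add: sum_negf sum_distrib_right mult.assoc)
  have c1: "c + ?s * c = 1" "c + c * ?s = 1" using c by (simp_all add: ring_distribs)
  have "u i + ?u i + u i * (- (?s * c)) = u i - u i * (c + ?s * c)" for i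
    by (simp add: ring_distribs)
  then show "mat_mult m (transvection m u b) (transvection m ?u b) = id_mat m"
    using u u' b by (intro transvection_mult) (simp_all only: s c1, simp)
  have "?u i + u i + ?u i * ?s = u i - u i * (c + c * ?s)" for i
    by (simp add: ring_distribs mult.assoc)
  then show "mat_mult m (transvection m ?u b) (transvection m u b) = id_mat m"
    using u u' b by (intro transvection_mult) (simp_all only: c1, simp)
qed

lemma transvection_zero [simp]:
  "transvection m (\<lambda>i. 0) b = id_mat m" "transvection m u (\<lambda>i. 0) = id_mat m"
  by (simp_all add: transvection_def)

section \<open>Stabilised matrices and the stabiliser of the last unit vector\<close>

lemma stab_mats: "a \<in> mats UNIV k \<Longrightarrow> stab k a \<in> mats UNIV (Suc k)"
  by (auto simp: stab_def mats_def less_Suc_eq)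

lemma stab_id [simp]: "stab k (id_mat k) = id_mat (Suc k)"
  by (auto simp: stab_def id_mat_def fun_eq_iff)

lemma stab_mult:
  fixes a :: "nat \<Rightarrow> nat \<Rightarrow> 'a::{ring,monoid_mult}"
  assumes "a \<in> mats UNIV k" "b \<in> mats UNIV k"
  shows "mat_mult (Suc k) (stab k a) (stab k b) = stab k (mat_mult k a b)"
proof (rule mats_eqI)
  fix i j assume "i < Suc k" "j < Suc k"
  have "a x k = 0" "a k x = 0" "b k x = 0" for x using assms by (auto simp: mats_def)
  then show "mat_mult (Suc k) (stab k a) (stab k b) i j = stab k (mat_mult k a b) i j"
    by (auto simp: mat_mult_def stab_def)
qed (use assms in \<open>auto intro!: mats_mult stab_mats\<close>)

lemma stab_GL:
  fixes a :: "nat \<Rightarrow> nat \<Rightarrow> 'a::{ring,monoid_mult}"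
  assumes "a \<in> GL UNIV k"
  shows "stab k a \<in> GL UNIV (Suc k)"
  by (rule GL_I[of _ _ "stab k (minv k a)"])
    (use GL_mats[OF assms] minv[OF assms] in \<open>simp_all add: stab_mats stab_mult\<close>)

lemma stab_column:
  fixes a :: "nat \<Rightarrow> nat \<Rightarrow> 'a::{ring,monoid_mult}"
  assumes "a \<in> mats UNIV k"
  shows "mat_vec (Suc k) (stab k a) (unit_vec k) = unit_vec k"
  using assms by (subst mat_vec_unit) (auto simp: stab_def unit_vec_def mats_def fun_eq_iff)

definition corner :: "nat \<Rightarrow> (nat \<Rightarrow> nat \<Rightarrow> 'a::zero) \<Rightarrow> (nat \<Rightarrow> nat \<Rightarrow> 'a)" where
  "corner k a = (\<lambda>i j. if i < k \<and> j < k then a i j else 0)"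

lemma corner_mats [simp]: "corner k a \<in> mats UNIV k"
  by (auto simp: corner_def mats_def)

lemma corner_id [simp]: "corner k (id_mat (Suc k)) = id_mat k"
  by (auto simp: corner_def id_mat_def fun_eq_iff)

lemma corner_stab: "a \<in> mats UNIV k \<Longrightarrow> corner k (stab k a) = a"
  by (rule mats_eqI[OF corner_mats]) (auto simp: corner_def stab_def)

text \<open>A matrix whose last column is the k-th unit vector has block form (a 0; r 1), so the
  summand of index k contributes nothing to the upper left block of the product.\<close>

lemma corner_mult:
  fixes a :: "nat \<Rightarrow> nat \<Rightarrow> 'a::{ring,monoid_mult}"
  assumes "mat_vec (Suc k) a (unit_vec k) = unit_vec k"
  shows "mat_mult k (corner k a) (corner k b) = corner k (mat_mult (Suc k) a b)"
proof (rule mats_eqI[OF mats_mult[OF corner_mats corner_mats] corner_mats])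
  fix i j assume ij: "i < k" "j < k"
  have "a i k = 0" using fun_cong[OF assms, of i] ij mat_vec_unit[of k "Suc k" a] by (simp add: unit_vec_def)
  then show "mat_mult k (corner k a) (corner k b) i j = corner k (mat_mult (Suc k) a b) i j"
    using ij by (auto simp: mat_mult_def corner_def)
qed

lemma corner_GL:
  fixes a :: "nat \<Rightarrow> nat \<Rightarrow> 'a::{ring,monoid_mult}"
  assumes "a \<in> GL UNIV (Suc k)" "mat_vec (Suc k) a (unit_vec k) = unit_vec k"
  shows "corner k a \<in> GL UNIV k"
proof (rule GL_I)
  have "mat_vec (Suc k) (minv (Suc k) a) (unit_vec k) = unit_vec k"
    using mat_vec_minv[OF assms(1), of "unit_vec k"] assms(2) by simp
  then show "mat_mult k (corner k a) (corner k (minv (Suc k) a)) = id_mat k"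
    "mat_mult k (corner k (minv (Suc k) a)) (corner k a) = id_mat k"
    using assms by (simp_all add: corner_mult minv)
qed auto

definition bottom_row :: "nat \<Rightarrow> (nat \<Rightarrow> nat \<Rightarrow> 'a::zero) \<Rightarrow> nat \<Rightarrow> 'a" where
  "bottom_row k a = (\<lambda>j. if j < k then a k j else 0)"

lemma bottom_row_vecs: "bottom_row k a \<in> vecs UNIV (Suc k)"
  by (simp add: bottom_row_def vecs_def)

text \<open>As \<open>r\<close> vanishes at k, its product with the k-th unit vector is 0. So the
  ring element to be inverted is 1, and column k is untouched.\<close>

lemma row_transvection:
  fixes r :: "nat \<Rightarrow> 'a::{ring,monoid_mult}"
  assumes "r \<in> vecs UNIV (Suc k)" "r k = 0"
  shows row_transvection_GL: "transvection (Suc k) (unit_vec k) r \<in> GL UNIV (Suc k)"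
    and row_transvection_column:
      "mat_vec (Suc k) (transvection (Suc k) (unit_vec k) r) (unit_vec k) = unit_vec k"
proof -
  have "(\<Sum>j<Suc k. r j * unit_vec k j) = 0"
    using assms by (auto simp: unit_vec_def intro!: sum.neutral)
  then show "transvection (Suc k) (unit_vec k) r \<in> GL UNIV (Suc k)"
    "mat_vec (Suc k) (transvection (Suc k) (unit_vec k) r) (unit_vec k) = unit_vec k"
    using assms by (auto intro!: transvection_GL[where c = 1] simp: mat_vec_transvection
        simp del: sum.lessThan_Suc)
qed

text \<open>Right multiplication by \<open>I - e_k r\<close> subtracts
  \<open>(a e_k) r = e_k r\<close> from \<open>a\<close>: only the bottom row changes, and it loses
  its entries left of the diagonal.\<close>

lemma clear_bottom_row:
  fixes a :: "nat \<Rightarrow> nat \<Rightarrow> 'a::{ring,monoid_mult}"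
  assumes a: "a \<in> mats UNIV (Suc k)" "mat_vec (Suc k) a (unit_vec k) = unit_vec k"
  shows "mat_mult (Suc k) a (transvection (Suc k) (unit_vec k) (\<lambda>j. - bottom_row k a j)) = stab k (corner k a)"
proof (rule mats_eqI)
  let ?r = "\<lambda>j. - bottom_row k a j"
  show "mat_mult (Suc k) a (transvection (Suc k) (unit_vec k) ?r) \<in> mats UNIV (Suc k)"
    using a bottom_row_vecs[of k a]
    by (intro mats_mult transvection_mats unit_vec_vecs) (auto simp: vecs_def)
  show "stab k (corner k a) \<in> mats UNIV (Suc k)" by (simp add: stab_mats)
  fix i j assume ij: "i < Suc k" "j < Suc k"
  have aik: "a x k = (if x = k then 1 else 0)" for x
    using fun_cong[OF a(2), of x] mat_vec_unit[of k "Suc k" a] by (simp add: unit_vec_def)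
  have "mat_mult (Suc k) a (transvection (Suc k) (unit_vec k) ?r) i j
      = mat_mult (Suc k) a (id_mat (Suc k)) i j + mat_vec (Suc k) a (unit_vec k) i * ?r j"
    by (simp add: mat_mult_def mat_vec_def transvection_def ring_distribs sum.distrib
        sum_distrib_right mult.assoc sum_subtractf sum_negf del: sum.lessThan_Suc)
  also have "\<dots> = a i j - (if i = k then bottom_row k a j else 0)"
    using a by (simp add: unit_vec_def)
  also have "\<dots> = stab k (corner k a) i j"
    using ij aik by (auto simp: stab_def corner_def bottom_row_def less_Suc_eq)
  finally show "mat_mult (Suc k) a (transvection (Suc k) (unit_vec k) ?r) i j = stab k (corner k a) i j" .
qed


section \<open>Continuous functions\<close>

lemma apply_bcontfun_sum:
  "apply_bcontfun (\<Sum>i\<in>I. f i) y = (\<Sum>i\<in>I. apply_bcontfun (f i) y)"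
  by (induction I rule: infinite_finite_induct) auto

text \<open>The partition of unity is pulled back from the compact image of the function, so that the
  space itself need not be normal.\<close>

lemma C_tensor_UNIV:
  assumes "compact (UNIV :: 'y::topological_space set)"
  shows "(C_tensor :: ('y \<Rightarrow>\<^sub>C 'a::unital_cstar_algebra) set) = UNIV"
proof -
  let ?S = "span {elem_tensor f a | f a. True} :: ('y \<Rightarrow>\<^sub>C 'a) set"
  have "\<exists>h\<in>?S. dist h g < e" if "e > 0" for g :: "'y \<Rightarrow>\<^sub>C 'a" and e
  proof -
    \<comment> \<open>The pointwise estimate yields a non-strict bound \<open>d\<close> on the norm;
      halving \<open>e\<close> makes it strict.\<close>
    define d where "d = e / 2"
    have d: "d > 0" using that by (simp add: d_def)
    have "compact (range g)" using assms by (intro compact_continuous_image) auto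
    then obtain C where C: "finite C" "range g \<subseteq> (\<Union>c\<in>C. ball c d)"
      by (rule compactE_image[where C = "range g" and f = "\<lambda>c. ball c d"]) (use d in auto)
    \<comment> \<open>Bump functions of the distance to finitely many centres:
      \<open>\<phi> c y\<close> is positive exactly when \<open>g y\<close> lies in the ball about
      \<open>c\<close>.\<close>
    define \<phi> where "\<phi> c y = max 0 (d - dist c (g y))" for c y
    define s where "s y = (\<Sum>c\<in>C. \<phi> c y)" for y
    have \<phi>_nonneg: "\<phi> c y \<ge> 0" for c y by (simp add: \<phi>_def)
    have s_pos: "s y > 0" for y
    proof -
      have "g y \<in> (\<Union>c\<in>C. ball c d)" using C(2) by blast
      then obtain c where "c \<in> C" "\<phi> c y > 0" by (auto simp: \<phi>_def)
      then show ?thesis unfolding s_def using C(1) \<phi>_nonneg by (intro sum_pos2) auto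
    qed
    define \<psi> where "\<psi> c y = \<phi> c y / s y" for c y
    have \<psi>_nonneg: "\<psi> c y \<ge> 0" for c y using \<phi>_nonneg s_pos by (simp add: \<psi>_def less_imp_le)
    have \<psi>_sum: "(\<Sum>c\<in>C. \<psi> c y) = 1" for y
      using s_pos[of y] by (simp add: \<psi>_def s_def flip: sum_divide_distrib)
    define f where "f c = Bcontfun (\<lambda>y. of_real (\<psi> c y) :: complex)" for c
    have f: "apply_bcontfun (f c) y = of_real (\<psi> c y)" if "c \<in> C" for c y
    proof -
      have "s y \<noteq> 0" for y using s_pos[of y] by simp
      then have "continuous_on UNIV (\<lambda>y. of_real (\<psi> c y) :: complex)"
        unfolding \<psi>_def s_def \<phi>_def by (intro continuous_intros) auto
      moreover have "\<psi> c y \<le> 1" for y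
        using member_le_sum[OF that, of "\<lambda>c. \<psi> c y"] \<psi>_nonneg \<psi>_sum[of y] C(1) by auto
      ultimately have "(\<lambda>y. of_real (\<psi> c y) :: complex) \<in> bcontfun"
        using \<psi>_nonneg by (intro bcontfun_normI[where b = 1]) auto
      then show ?thesis by (simp add: f_def Bcontfun_inverse)
    qed
    define h where "h = (\<Sum>c\<in>C. elem_tensor (f c) c)"
    have "h \<in> ?S" unfolding h_def by (intro span_sum span_base) auto
    moreover have "dist h g < e"
    proof -
      have "norm ((h - g) y) \<le> d" for y
      proof -
        have "(h - g) y = (\<Sum>c\<in>C. \<psi> c y *\<^sub>R c) - (\<Sum>c\<in>C. \<psi> c y) *\<^sub>R g y"
          by (simp add: h_def apply_bcontfun_sum f scaleC_of_real \<psi>_sum)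
        \<comment> \<open>The weights sum to 1, so the error is an average of the vectors
          \<open>c - g y\<close>, and a weight is nonzero only for a centre within \<open>d\<close>
          of \<open>g y\<close>.\<close>
        also have "\<dots> = (\<Sum>c\<in>C. \<psi> c y *\<^sub>R (c - g y))"
          by (simp add: scaleR_sum_left sum_subtractf scaleR_diff_right)
        also have "norm \<dots> \<le> (\<Sum>c\<in>C. \<psi> c y * d)"
        proof (rule sum_norm_le)
          fix c assume "c \<in> C"
          show "norm (\<psi> c y *\<^sub>R (c - g y)) \<le> \<psi> c y * d"
          proof (cases "\<psi> c y = 0")
            case False
            then have "norm (c - g y) \<le> d" by (auto simp: \<psi>_def \<phi>_def dist_norm)
            then show ?thesis using \<psi>_nonneg[of c y] by (simp add: mult_left_mono)
          qed simp
        qed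
        also have "\<dots> = d" using \<psi>_sum[of y] by (simp flip: sum_distrib_right)
        finally show ?thesis .
      qed
      then have "norm (h - g) \<le> d" by (rule norm_bound)
      then show ?thesis using that by (simp add: d_def dist_norm)
    qed
    ultimately show ?thesis by blast
  qed
  then show ?thesis unfolding C_tensor_def by (auto simp: closure_approachable)
qed

section \<open>Continuity of the matrix operations, including inversion\<close>

lemma continuous_on_vector_iff:
  fixes F :: "'b::topological_space \<Rightarrow> nat \<Rightarrow> 'a::topological_space"
  shows "continuous_on S F \<longleftrightarrow> (\<forall>i. continuous_on S (\<lambda>p. F p i))"
  using continuous_on_coordinatewise_then_product[of S F]
    continuous_on_product_then_coordinatewise[of S F] by blast

lemma continuous_on_matrix_iff:
  fixes F :: "'b::topological_space \<Rightarrow> nat \<Rightarrow> nat \<Rightarrow> 'a::topological_space"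
  shows "continuous_on S F \<longleftrightarrow> (\<forall>i j. continuous_on S (\<lambda>p. F p i j))"
  by (simp add: continuous_on_vector_iff)

lemma continuous_on_mat_mult:
  fixes F G :: "'b::topological_space \<Rightarrow> nat \<Rightarrow> nat \<Rightarrow> 'a::real_normed_algebra"
  assumes "continuous_on S F" "continuous_on S G"
  shows "continuous_on S (\<lambda>p. mat_mult m (F p) (G p))"
  using assms unfolding continuous_on_matrix_iff mat_mult_def by (auto intro!: continuous_intros)

lemma continuous_on_mat_vec:
  fixes F :: "'b::topological_space \<Rightarrow> nat \<Rightarrow> nat \<Rightarrow> 'a::real_normed_algebra"
  assumes "continuous_on S F" "continuous_on S v"
  shows "continuous_on S (\<lambda>p. mat_vec m (F p) (v p))"
  using assms unfolding continuous_on_matrix_iff continuous_on_vector_iff mat_vec_def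
  by (auto intro!: continuous_intros)

lemma continuous_on_transvection:
  fixes u b :: "'b::topological_space \<Rightarrow> nat \<Rightarrow> 'a::{real_normed_algebra,monoid_mult}"
  assumes "continuous_on S u" "continuous_on S b"
  shows "continuous_on S (\<lambda>p. transvection m (u p) (b p))"
  using assms unfolding continuous_on_matrix_iff continuous_on_vector_iff transvection_def
  by (auto intro!: continuous_intros)

lemma continuous_on_stab:
  fixes F :: "'b::topological_space \<Rightarrow> nat \<Rightarrow> nat \<Rightarrow> 'a::{topological_space,zero,one}"
  assumes "continuous_on S F"
  shows "continuous_on S (\<lambda>p. stab k (F p))"
  unfolding continuous_on_matrix_iff
proof (intro allI)
  fix i j
  show "continuous_on S (\<lambda>p. stab k (F p) i j)"
    using assms by (cases "i = k \<and> j = k") (auto simp: stab_def continuous_on_matrix_iff)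
qed

lemma continuous_on_corner:
  fixes F :: "'b::topological_space \<Rightarrow> nat \<Rightarrow> nat \<Rightarrow> 'a::{topological_space,zero}"
  assumes "continuous_on S F"
  shows "continuous_on S (\<lambda>p. corner k (F p))"
  unfolding continuous_on_matrix_iff
proof (intro allI)
  fix i j
  show "continuous_on S (\<lambda>p. corner k (F p) i j)"
    using assms by (cases "i < k \<and> j < k") (auto simp: corner_def continuous_on_matrix_iff)
qed

text \<open>The entrywise l1 norm: it dominates every entry of the block, is submultiplicative by
  elementary estimates, and measures entrywise convergence.\<close>

definition mat_norm :: "nat \<Rightarrow> (nat \<Rightarrow> nat \<Rightarrow> 'a::real_normed_vector) \<Rightarrow> real" where
  "mat_norm m a = (\<Sum>i<m. \<Sum>j<m. norm (a i j))"

lemma mat_norm_nonneg: "mat_norm m a \<ge> 0"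
  by (simp add: mat_norm_def sum_nonneg)

lemma norm_le_mat_norm:
  assumes "i < m" "j < m"
  shows "norm (a i j) \<le> mat_norm m a"
proof -
  have "norm (a i j) \<le> (\<Sum>j<m. norm (a i j))"
    using assms by (intro member_le_sum) auto
  also have "\<dots> \<le> mat_norm m a"
    unfolding mat_norm_def using assms
    by (intro member_le_sum[where f = "\<lambda>i. \<Sum>j<m. norm (a i j)"]) (auto simp: sum_nonneg)
  finally show ?thesis .
qed

lemma mat_norm_mult:
  fixes a b :: "nat \<Rightarrow> nat \<Rightarrow> 'a::real_normed_algebra"
  shows "mat_norm m (mat_mult m a b) \<le> mat_norm m a * mat_norm m b"
proof -
  have "(\<Sum>j<m. norm (mat_mult m a b i j)) \<le> (\<Sum>k<m. norm (a i k) * mat_norm m b)" for i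
  proof -
    have "(\<Sum>j<m. norm (mat_mult m a b i j)) \<le> (\<Sum>j<m. \<Sum>k<m. norm (a i k) * norm (b k j))"
      unfolding mat_mult_def
      by (intro sum_mono order.trans[OF norm_sum] norm_mult_ineq)
    also have "\<dots> = (\<Sum>k<m. norm (a i k) * (\<Sum>j<m. norm (b k j)))"
      by (subst sum.swap) (simp add: sum_distrib_left)
    also have "\<dots> \<le> (\<Sum>k<m. norm (a i k) * mat_norm m b)"
      unfolding mat_norm_def
      by (intro sum_mono mult_left_mono member_le_sum[where f = "\<lambda>k. \<Sum>j<m. norm (b k j)"])
        (auto simp: sum_nonneg)
    finally show ?thesis .
  qed
  then have "mat_norm m (mat_mult m a b) \<le> (\<Sum>i<m. \<Sum>k<m. norm (a i k) * mat_norm m b)"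
    unfolding mat_norm_def[of m "mat_mult m a b"] by (rule sum_mono)
  then show ?thesis
    by (simp add: mat_norm_def[of m a] sum_distrib_right)
qed

lemma mat_norm_triangle: "mat_norm m a \<le> mat_norm m b + mat_norm m (\<lambda>i j. a i j - b i j)"
  unfolding mat_norm_def by (simp only: flip: sum.distrib) (intro sum_mono norm_triangle_sub)

lemma mat_mult_diff:
  fixes a b c :: "nat \<Rightarrow> nat \<Rightarrow> 'a::{ring,monoid_mult}"
  shows "mat_mult m (\<lambda>i j. a i j - b i j) c = (\<lambda>i j. mat_mult m a c i j - mat_mult m b c i j)"
    and "mat_mult m c (\<lambda>i j. a i j - b i j) = (\<lambda>i j. mat_mult m c a i j - mat_mult m c b i j)"
  by (simp_all add: mat_mult_def left_diff_distrib right_diff_distrib sum_subtractf)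

text \<open>No power series is needed: with \<open>b = a\<inverse>\<close> and \<open>b\<^sub>0 = a\<^sub>0\<inverse>\<close>, the identity
  \<open>b - b\<^sub>0 = b\<^sub>0 (a\<^sub>0 - a) b\<close> first bounds \<open>b\<close> and then \<open>b - b\<^sub>0\<close>.\<close>

lemma minv_diff_bound:
  fixes a a0 :: "nat \<Rightarrow> nat \<Rightarrow> 'a::{real_normed_algebra,monoid_mult}"
  assumes a: "a \<in> GL UNIV m" and a0: "a0 \<in> GL UNIV m"
    and small: "mat_norm m (minv m a0) * mat_norm m (\<lambda>i j. a0 i j - a i j) \<le> 1/2"
  shows "mat_norm m (\<lambda>i j. minv m a i j - minv m a0 i j)
           \<le> 2 * (mat_norm m (minv m a0))\<^sup>2 * mat_norm m (\<lambda>i j. a0 i j - a i j)"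
proof -
  let ?b = "minv m a" and ?c = "minv m a0" and ?d = "\<lambda>i j. a0 i j - a i j"
  let ?e = "\<lambda>i j. ?b i j - ?c i j"
  have "mat_mult m ?c (mat_mult m ?d ?b) = (\<lambda>i j. mat_mult m ?c (mat_mult m a0 ?b) i j - ?c i j)"
    by (simp only: mat_mult_diff minv_right[OF a] mat_mult_id_right[OF minv_mats[OF a0]])
  moreover have "mat_mult m ?c (mat_mult m a0 ?b) = ?b"
    by (simp only: minv_left[OF a0] mat_mult_id_left[OF minv_mats[OF a]] flip: mat_mult_assoc)
  ultimately have "?e = mat_mult m ?c (mat_mult m ?d ?b)" by simp
  then have "mat_norm m ?e \<le> mat_norm m ?c * mat_norm m (mat_mult m ?d ?b)"
    by (simp only: mat_norm_mult)
  also have "\<dots> \<le> mat_norm m ?c * (mat_norm m ?d * mat_norm m ?b)"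
    by (intro mult_left_mono mat_norm_mult mat_norm_nonneg)
  finally have e: "mat_norm m ?e \<le> (mat_norm m ?c * mat_norm m ?d) * mat_norm m ?b"
    by (simp add: mult.assoc)
  also have "\<dots> \<le> 1/2 * mat_norm m ?b"
    by (intro mult_right_mono small mat_norm_nonneg)
  finally have "mat_norm m ?b \<le> 2 * mat_norm m ?c"
    using mat_norm_triangle[of m ?b ?c] by simp
  then have "(mat_norm m ?c * mat_norm m ?d) * mat_norm m ?b
      \<le> (mat_norm m ?c * mat_norm m ?d) * (2 * mat_norm m ?c)"
    by (intro mult_left_mono mult_nonneg_nonneg mat_norm_nonneg)
  with e show ?thesis by (simp add: power2_eq_square mult_ac)
qed

lemma eventually_at_in_set: "\<forall>\<^sub>F p in at q within S. p \<in> S"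
  by (auto simp: eventually_at_filter)

text \<open>With \<open>c\<close> the norm of the inverse at the fixed point \<open>q\<close>, the
  error is at most \<open>2 * c^2 * \<delta>\<close>, which tends to 0 with the distance
  \<open>\<delta>\<close> of the matrices. As \<open>c\<close> is fixed, \<open>c * \<delta>\<close>
  drops below the required 1/2 near \<open>q\<close>.\<close>

lemma continuous_on_minv:
  fixes F :: "'b::topological_space \<Rightarrow> nat \<Rightarrow> nat \<Rightarrow> 'a::{real_normed_algebra,monoid_mult}"
  assumes F: "continuous_on S F" and GL: "\<And>p. p \<in> S \<Longrightarrow> F p \<in> GL UNIV m"
  shows "continuous_on S (\<lambda>p. minv m (F p))"
  unfolding continuous_on_matrix_iff continuous_on_def
proof (intro allI ballI)
  fix i j q assume q: "q \<in> S"
  define \<delta> where "\<delta> p = mat_norm m (\<lambda>i j. F q i j - F p i j)" for p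
  define c where "c = mat_norm m (minv m (F q))"
  have F': "((\<lambda>p. F p i j) \<longlongrightarrow> F q i j) (at q within S)" for i j
    using F q unfolding continuous_on_matrix_iff continuous_on_def by blast
  have "(\<delta> \<longlongrightarrow> mat_norm m (\<lambda>i j. F q i j - F q i j)) (at q within S)"
    unfolding \<delta>_def mat_norm_def by (intro tendsto_intros F')
  then have \<delta>: "(\<delta> \<longlongrightarrow> 0) (at q within S)" by (simp add: mat_norm_def)
  then have "((\<lambda>p. c * \<delta> p) \<longlongrightarrow> c * 0) (at q within S)" by (intro tendsto_intros)
  then have "\<forall>\<^sub>F p in at q within S. c * \<delta> p < 1/2" by (intro order_tendstoD) auto
  then have "\<forall>\<^sub>F p in at q within S. norm (minv m (F p) i j - minv m (F q) i j) \<le> 2 * c\<^sup>2 * \<delta> p"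
    using eventually_at_in_set
  proof (rule eventually_elim2)
    fix p assume p: "c * \<delta> p < 1/2" "p \<in> S"
    have "norm (minv m (F p) i j - minv m (F q) i j)
        \<le> mat_norm m (\<lambda>i j. minv m (F p) i j - minv m (F q) i j)"
    proof (cases "i < m \<and> j < m")
      case True
      then show ?thesis by (intro norm_le_mat_norm) auto
    next
      case False
      then show ?thesis
        using minv_mats[OF GL[OF p(2)]] minv_mats[OF GL[OF q]] mat_norm_nonneg
        by (auto simp: mats_def)
    qed
    also have "\<dots> \<le> 2 * c\<^sup>2 * \<delta> p"
      unfolding \<delta>_def c_def using p GL q by (intro minv_diff_bound) (auto simp: \<delta>_def c_def)
    finally show "norm (minv m (F p) i j - minv m (F q) i j) \<le> 2 * c\<^sup>2 * \<delta> p" .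
  qed
  moreover have "((\<lambda>p. 2 * c\<^sup>2 * \<delta> p) \<longlongrightarrow> 0) (at q within S)"
    using tendsto_mult[OF tendsto_const \<delta>, of "2 * c\<^sup>2"] by simp
  ultimately have "((\<lambda>p. minv m (F p) i j - minv m (F q) i j) \<longlongrightarrow> 0) (at q within S)"
    by (rule Lim_null_comparison)
  then show "((\<lambda>p. minv m (F p) i j) \<longlongrightarrow> minv m (F q) i j) (at q within S)"
    by (rule LIM_zero_cancel)
qed

section \<open>Lifting homotopies of unimodular vectors\<close>

lemma neumann_inverse:
  fixes x :: "'a::{real_normed_algebra,banach,monoid_mult}"
  assumes "norm (1 - x) < 1"
  obtains y where "x * y = 1" "y * x = 1"
proof
  let ?z = "1 - x"
  \<comment> \<open>The norm of the unit need not be 1 in this class; as the bound for exponent 0 it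
    stays as a factor throughout.\<close>
  have "norm (?z ^ n) \<le> norm (1::'a) * norm ?z ^ n" for n
  proof (induction n)
    case (Suc n)
    have "norm (?z ^ Suc n) \<le> norm ?z * norm (?z ^ n)" by (simp only: power_Suc norm_mult_ineq)
    also have "\<dots> \<le> norm ?z * (norm (1::'a) * norm ?z ^ n)" by (intro mult_left_mono Suc.IH) auto
    finally show ?case by (simp add: mult_ac)
  qed simp
  moreover have "summable (\<lambda>n. norm (1::'a) * norm ?z ^ n)"
    using assms by (intro summable_mult summable_geometric) auto
  ultimately have sum: "summable (\<lambda>n. ?z ^ n)"
    by (rule summable_comparison_test'[where N = 0, rotated])
  \<comment> \<open>Written this way, \<open>x\<close> makes both products with the geometric series
    telescope.\<close>
  have x: "x = 1 - ?z" by simp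
  have *: "(\<Sum>n. ?z ^ n - ?z ^ Suc n) = 1"
    using telescope_sums'[OF summable_LIMSEQ_zero[OF sum]] by (simp add: sums_iff)
  have "x * (\<Sum>n. ?z ^ n) = (\<Sum>n. x * ?z ^ n)" by (rule suminf_mult[OF sum, symmetric])
  also have "(\<lambda>n. x * ?z ^ n) = (\<lambda>n. ?z ^ n - ?z ^ Suc n)"
    by (subst (1) x) (simp add: left_diff_distrib)
  finally show "x * (\<Sum>n. ?z ^ n) = 1" using * by simp
  have "(\<Sum>n. ?z ^ n) * x = (\<Sum>n. ?z ^ n * x)" by (rule suminf_mult2[OF sum])
  also have "(\<lambda>n. ?z ^ n * x) = (\<lambda>n. ?z ^ n - ?z ^ Suc n)"
    by (subst (2) x) (simp only: right_diff_distrib power_Suc2 mult_1_right)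
  finally show "(\<Sum>n. ?z ^ n) * x = 1" using * by simp
qed

text \<open>X carries no metric, so compactness stands in for uniform continuity: the points where
  \<open>\<phi>\<close> is at least 1 form a compact set missing the diagonal, and on it, unless it
  is empty, the distance of s and t has a positive minimum.\<close>

lemma uniform_near_diagonal:
  fixes \<phi> :: "(real \<times> real) \<times> 'x::topological_space \<Rightarrow> real"
  assumes X: "compact (UNIV :: 'x set)"
    and cont: "continuous_on (({0..1} \<times> {0..1}) \<times> UNIV) \<phi>"
    and diag: "\<And>s x. s \<in> {0..1} \<Longrightarrow> \<phi> ((s, s), x) < 1"
  obtains \<delta> where "\<delta> > 0"
    "\<And>s t x. s \<in> {0..1} \<Longrightarrow> t \<in> {0..1} \<Longrightarrow> \<bar>s - t\<bar> < \<delta> \<Longrightarrow> \<phi> ((s, t), x) < 1"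
proof -
  let ?D = "({0..1::real} \<times> {0..1::real}) \<times> (UNIV :: 'x set)"
  let ?C = "?D \<inter> \<phi> -` {1..}"
  have "compact ?D" by (intro compact_Times X compact_Icc)
  then have comp: "compact ?C"
    by (rule closedin_compact) (rule continuous_closedin_preimage[OF cont closed_atLeast])
  show thesis
  proof (cases "?C = {}")
    case True
    then show thesis by (intro that[of 1]) (auto simp: not_le disjoint_iff)
  next
    case False
    have "continuous_on ?C (\<lambda>p. \<bar>fst (fst p) - snd (fst p)\<bar>)" by (intro continuous_intros)
    then obtain p where p: "p \<in> ?C" and
      min: "\<And>q. q \<in> ?C \<Longrightarrow> \<bar>fst (fst p) - snd (fst p)\<bar> \<le> \<bar>fst (fst q) - snd (fst q)\<bar>"
      using continuous_attains_inf[OF comp False] by blast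
    show thesis
    proof (rule that)
      obtain s t x where [simp]: "p = ((s, t), x)" by (metis surj_pair)
      have "s \<noteq> t" using p diag[of t x] by auto
      then show "\<bar>fst (fst p) - snd (fst p)\<bar> > 0" by simp
      fix s t x assume "s \<in> {0..1}" "t \<in> {0..1}" "\<bar>s - t\<bar> < \<bar>fst (fst p) - snd (fst p)\<bar>"
      then show "\<phi> ((s, t), x) < 1" using min[of "((s, t), x)"] by (auto simp: not_le[symmetric])
    qed
  qed
qed

text \<open>Over a short time interval starting at \<open>s\<close>, the transvection
  \<open>I + (v\<^sub>t - v\<^sub>s) b\<^sub>s\<close>, where \<open>b\<^sub>s v\<^sub>s = 1\<close>, moves \<open>v\<^sub>s\<close> to \<open>v\<^sub>t\<close>. Freezing \<open>t\<close> outside the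
  \<open>j\<close>-th of \<open>n\<close> equal intervals (\<open>clamp\<close>) lets the pieces be multiplied instead of glued.\<close>

lemma homotopy_lifting:
  fixes v b :: "real \<times> 'x::topological_space \<Rightarrow> nat \<Rightarrow> 'a::{real_normed_algebra,banach,monoid_mult}"
  assumes X: "compact (UNIV :: 'x set)"
    and v: "continuous_on ({0..1} \<times> UNIV) v" "\<And>p. p \<in> {0..1} \<times> UNIV \<Longrightarrow> v p \<in> vecs UNIV m"
    and b: "continuous_on ({0..1} \<times> UNIV) b" "\<And>p. p \<in> {0..1} \<times> UNIV \<Longrightarrow> b p \<in> vecs UNIV m"
    and bv: "\<And>p. p \<in> {0..1} \<times> UNIV \<Longrightarrow> (\<Sum>i<m. b p i * v p i) = 1"
  shows "\<exists>H. continuous_on ({0..1} \<times> UNIV) H \<and> (\<forall>p\<in>{0..1} \<times> UNIV. H p \<in> GL UNIV m) \<and>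
    (\<forall>x. H (0, x) = id_mat m) \<and> (\<forall>t\<in>{0..1}. \<forall>x. mat_vec m (H (t, x)) (v (0, x)) = v (t, x))"
proof -
  let ?D = "{0..1::real} \<times> (UNIV :: 'x set)"
  \<comment> \<open>At \<open>((s, t), x)\<close> this is the distance from 1 of
    \<open>b_s v_t = 1 + b_s (v_t - v_s)\<close>, the ring element whose invertibility makes the
    transvection from time s to time t invertible.\<close>
  define \<phi> where "\<phi> p = norm (1 - (\<Sum>i<m. b (fst (fst p), snd p) i * v (snd (fst p), snd p) i))"
    for p :: "(real \<times> real) \<times> 'x"
  have v': "continuous_on ?D (\<lambda>p. v p i)" and b': "continuous_on ?D (\<lambda>p. b p i)" for i
    using v(1) b(1) by (auto simp: continuous_on_vector_iff)
  have "continuous_on (({0..1} \<times> {0..1}) \<times> UNIV) \<phi>"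
  proof -
    have "continuous_on (({0..1} \<times> {0..1}) \<times> UNIV) (\<lambda>p :: (real \<times> real) \<times> 'x. b (fst (fst p), snd p) i)"
      "continuous_on (({0..1} \<times> {0..1}) \<times> UNIV) (\<lambda>p :: (real \<times> real) \<times> 'x. v (snd (fst p), snd p) i)" for i
      by (rule continuous_on_compose2[OF b'] continuous_on_compose2[OF v'];
          auto intro!: continuous_intros)+
    then show ?thesis unfolding \<phi>_def by (intro continuous_intros)
  qed
  then obtain \<delta> where \<delta>: "\<delta> > 0"
    "\<And>s t x. s \<in> {0..1} \<Longrightarrow> t \<in> {0..1} \<Longrightarrow> \<bar>s - t\<bar> < \<delta> \<Longrightarrow> \<phi> ((s, t), x) < 1"
    by (rule uniform_near_diagonal[OF X]) (auto simp: \<phi>_def bv)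
  obtain n :: nat where n: "n \<noteq> 0" "1 / real n < \<delta>"
    using real_arch_inverse[of \<delta>] \<delta>(1) by (auto simp: inverse_eq_divide)
  define \<tau> where "\<tau> j = real j / real n" for j
  have \<tau>_Suc: "\<tau> (Suc j) = \<tau> j + 1 / real n" for j by (simp add: \<tau>_def add_divide_distrib)
  have \<tau>: "\<tau> j \<in> {0..1}" if "j \<le> n" for j using that n by (simp add: \<tau>_def)
  have \<tau>0: "\<tau> 0 = 0" and \<tau>n: "\<tau> n = 1" using n by (simp_all add: \<tau>_def)
  define clamp where "clamp j t = max (\<tau> j) (min t (\<tau> (Suc j)))" for j t
  have clamp: "clamp j t \<in> {0..1}" "\<bar>\<tau> j - clamp j t\<bar> < \<delta>" if "j < n" for j t
  proof -
    have "0 < 1 / real n" using n by simp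
    then have "\<tau> j \<le> clamp j t" "clamp j t \<le> \<tau> j + 1 / real n"
      using \<tau>_Suc[of j] by (auto simp: clamp_def)
    then show "clamp j t \<in> {0..1}" "\<bar>\<tau> j - clamp j t\<bar> < \<delta>"
      using that \<tau>[of j] \<tau>[of "Suc j"] n \<tau>_Suc[of j] by auto
  qed
  define P where "P j p = transvection m (\<lambda>i. v (clamp j (fst p), snd p) i - v (\<tau> j, snd p) i)
    (b (\<tau> j, snd p))" for j p
  have P_cont: "continuous_on ?D (P j)" if "j < n" for j
  proof -
    have 1: "continuous_on ?D (\<lambda>p. (clamp j (fst p), snd p))"
      unfolding clamp_def by (intro continuous_intros)
    have 2: "continuous_on ?D (\<lambda>p. (\<tau> j, snd p))" by (intro continuous_intros)
    have "continuous_on ?D (\<lambda>p. v (clamp j (fst p), snd p) i)" for i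
      by (rule continuous_on_compose2[OF v' 1]) (use clamp[OF that] in auto)
    moreover have "continuous_on ?D (\<lambda>p. v (\<tau> j, snd p) i)" for i
      by (rule continuous_on_compose2[OF v' 2]) (use \<tau>[of j] that in auto)
    moreover have "continuous_on ?D (\<lambda>p. b (\<tau> j, snd p))"
      by (rule continuous_on_compose2[OF b(1) 2]) (use \<tau>[of j] that in auto)
    ultimately show ?thesis
      unfolding P_def
      by (intro continuous_on_transvection) (auto simp: continuous_on_vector_iff intro!: continuous_intros)
  qed
  have P_GL: "P j p \<in> GL UNIV m" if "j < n" for j p
  proof -
    have *: "(\<tau> j, snd p) \<in> ?D" "(clamp j (fst p), snd p) \<in> ?D" using \<tau>[of j] clamp[OF that] that by auto
    have u: "(\<lambda>i. v (clamp j (fst p), snd p) i - v (\<tau> j, snd p) i) \<in> vecs UNIV m"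
      using v(2)[OF *(1)] v(2)[OF *(2)] by (auto simp: vecs_def)
    have eq: "1 + (\<Sum>i<m. b (\<tau> j, snd p) i * (v (clamp j (fst p), snd p) i - v (\<tau> j, snd p) i))
      = (\<Sum>i<m. b (\<tau> j, snd p) i * v (clamp j (fst p), snd p) i)"
      using bv[OF *(1)] by (simp add: right_diff_distrib sum_subtractf)
    have "norm (1 - (\<Sum>i<m. b (\<tau> j, snd p) i * v (clamp j (fst p), snd p) i)) < 1"
      using \<delta>(2)[of "\<tau> j" "clamp j (fst p)" "snd p"] \<tau>[of j] clamp[OF that] that by (simp add: \<phi>_def)
    then obtain y where "(\<Sum>i<m. b (\<tau> j, snd p) i * v (clamp j (fst p), snd p) i) * y = 1"
      "y * (\<Sum>i<m. b (\<tau> j, snd p) i * v (clamp j (fst p), snd p) i) = 1"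
      by (rule neumann_inverse)
    then show ?thesis unfolding P_def
      by (intro transvection_GL[OF u b(2)[OF *(1)]]) (simp_all only: eq)
  qed
  \<comment> \<open>The j-th factor is the identity up to time \<open>\<tau> j\<close>, then follows
    \<open>v\<close> from there, and is frozen after \<open>\<tau> (Suc j)\<close>.\<close>
  have P_move: "mat_vec m (P j (t, x)) (v (min t (\<tau> j), x)) = v (min t (\<tau> (Suc j)), x)"
    if "j < n" "t \<in> {0..1}" for j t x
  proof (cases "t \<le> \<tau> j")
    case True
    have "\<tau> j \<le> \<tau> (Suc j)" using \<tau>_Suc[of j] by simp
    with True have "clamp j t = \<tau> j" "min t (\<tau> (Suc j)) = t" "min t (\<tau> j) = t"
      by (auto simp: clamp_def)
    then show ?thesis using v(2)[of "(t, x)"] that by (simp add: P_def)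
  next
    case False
    then have *: "clamp j t = min t (\<tau> (Suc j))" "min t (\<tau> j) = \<tau> j"
      using \<tau>_Suc[of j] by (auto simp: clamp_def)
    have "(\<tau> j, x) \<in> ?D" using \<tau>[of j] that by simp
    then show ?thesis
      using v(2) bv by (simp add: P_def * mat_vec_transvection)
  qed
  \<comment> \<open>The newest factor stands on the left, because it acts on the vector that the
    earlier ones have already moved to time \<open>min t (\<tau> j)\<close>. For j = n this time is
    t.\<close>
  define Q where "Q = rec_nat (\<lambda>p. id_mat m) (\<lambda>j R p. mat_mult m (P j p) (R p))"
  have Q0: "Q 0 p = id_mat m" and Q_Suc: "Q (Suc j) p = mat_mult m (P j p) (Q j p)" for j p
    by (simp_all add: Q_def)
  have Q: "continuous_on ?D (Q j) \<and> (\<forall>p\<in>?D. Q j p \<in> GL UNIV m) \<and> (\<forall>x. Q j (0, x) = id_mat m) \<and>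
     (\<forall>t\<in>{0..1}. \<forall>x. mat_vec m (Q j (t, x)) (v (0, x)) = v (min t (\<tau> j), x))" if "j \<le> n" for j
    using that
  proof (induction j)
    case 0
    have "continuous_on ?D (Q 0)" by (simp add: Q0[abs_def])
    then show ?case using v(2) by (auto simp: Q0 \<tau>0 min_def)
  next
    case (Suc j)
    then have j: "j < n" by simp
    note IH = Suc.IH[OF less_imp_le[OF j]]
    have "continuous_on ?D (Q (Suc j))"
      unfolding Q_Suc[abs_def] using IH P_cont[OF j] by (intro continuous_on_mat_mult) auto
    moreover have "Q (Suc j) p \<in> GL UNIV m" if "p \<in> ?D" for p
      using that IH P_GL[OF j] by (auto simp: Q_Suc intro!: GL_mult)
    moreover have "Q (Suc j) (0, x) = id_mat m" for x
    proof -
      have "clamp j 0 = \<tau> j" using \<tau>[of j] \<tau>[of "Suc j"] j by (auto simp: clamp_def)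
      then have "P j (0, x) = id_mat m" by (simp add: P_def)
      then show ?thesis using IH by (simp add: Q_Suc)
    qed
    moreover have "mat_vec m (Q (Suc j) (t, x)) (v (0, x)) = v (min t (\<tau> (Suc j)), x)"
      if "t \<in> {0..1}" for t x
      using that IH P_move[OF j that, of x] by (simp add: Q_Suc mat_vec_mult)
    ultimately show ?case by blast
  qed
  have "mat_vec m (Q n (t, x)) (v (0, x)) = v (t, x)" if "t \<in> {0..1}" for t x
    using Q[of n] that by (auto simp: \<tau>n min_def)
  then show ?thesis using Q[of n] by blast
qed


section \<open>Functions on the suspension\<close>

text \<open>One common value suffices for all glued points: the end at time 1 is collapsed to
  \<open>(1, basepoint)\<close>, which lies on the line over the base point and so is identified
  with \<open>(0, basepoint)\<close>.\<close>

definition susp_compatible :: "(real \<times> 'x::pointed_topological_space \<Rightarrow> 'b) \<Rightarrow> bool" where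
  "susp_compatible F \<longleftrightarrow> (\<forall>x. F (0, x) = F (0, basepoint)) \<and> (\<forall>x. F (1, x) = F (0, basepoint)) \<and>
     (\<forall>s\<in>{0..1}. F (s, basepoint) = F (0, basepoint))"

lemma susp_compatibleD:
  assumes "susp_compatible F"
  shows "F (0, x) = F (0, basepoint)" "F (1, x) = F (0, basepoint)"
    "s \<in> {0..1} \<Longrightarrow> F (s, basepoint) = F (0, basepoint)"
  using assms unfolding susp_compatible_def by blast+

lemma susp_compatibleI:
  assumes "\<And>x. F (0, x) = c" "\<And>x. F (1, x) = c" "\<And>s. s \<in> {0..1} \<Longrightarrow> F (s, basepoint) = c"
  shows "susp_compatible F"
  using assms by (simp add: susp_compatible_def)

lemma susp_compatible_compose: "susp_compatible F \<Longrightarrow> susp_compatible (\<lambda>p. h (F p))"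
  by (intro susp_compatibleI[of _ "h (F (0, basepoint))"] arg_cong[of _ _ h] susp_compatibleD)

lemma susp_compatible_respects:
  assumes "susp_compatible F" "susp_rel p q"
  shows "F p = F q"
proof -
  have glue: "F y = F z" if "susp_glue y z" for y z
    using that
  proof cases
    case (1 x)
    show ?thesis unfolding 1 by (rule susp_compatibleD(1)[OF assms(1)])
  next
    case (2 x)
    show ?thesis unfolding 2
      by (rule trans[OF susp_compatibleD(2)[OF assms(1)] susp_compatibleD(2)[OF assms(1), symmetric]])
  next
    case (3 s)
    show ?thesis unfolding 3(1,2) by (rule susp_compatibleD(3)[OF assms(1) 3(3)])
  qed
  have "equivclp susp_glue p q" using assms(2) by (simp add: susp_rel_def)
  then show ?thesis
  proof (induction rule: equivclp_induct)
    case (step y z)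
    from step(2) have "F y = F z" using glue by metis
    with step show ?case by simp
  qed simp
qed

lemma susp_rel_refl: "p \<in> {0..1} \<times> UNIV \<Longrightarrow> susp_rel p p"
  by (simp add: susp_rel_def)

lemma abs_susp_eqI: "susp_rel p q \<Longrightarrow> abs_susp p = abs_susp q"
  by (rule Quotient3_rel_abs[OF Quotient3_susp])

lemma susp_rel_rep_abs: "p \<in> {0..1} \<times> UNIV \<Longrightarrow> susp_rel (rep_susp (abs_susp p)) p"
  by (rule rep_abs_rsp_left[OF Quotient3_susp susp_rel_refl])

lemma susp_compatible_abs_susp: "susp_compatible (\<lambda>p. h (abs_susp p))"
proof -
  have s: "susp_rel (s, basepoint :: 'a) (0, basepoint)" if "s \<in> {0..1}" for s
    unfolding susp_rel_def using that susp_glue.intros(3)[OF that] by (auto intro: r_into_equivclp)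
  have "susp_rel (0, x) (0, basepoint)" "susp_rel (1, x) (1, basepoint)" for x :: 'a
    unfolding susp_rel_def by (auto intro: r_into_equivclp susp_glue.intros)
  note eq = this[THEN abs_susp_eqI] s[THEN abs_susp_eqI]
  show ?thesis
  proof (rule susp_compatibleI)
    show "h (abs_susp (0, x)) = h (abs_susp (0, basepoint))" for x :: 'a by (rule arg_cong[OF eq(1)])
    show "h (abs_susp (1, x)) = h (abs_susp (0, basepoint))" for x :: 'a
      using arg_cong[OF trans[OF eq(2) eq(3)[of 1]], of h x] by simp
    show "h (abs_susp (s, basepoint)) = h (abs_susp (0, basepoint :: 'a))" if "s \<in> {0..1}" for s
      by (rule arg_cong[OF eq(3)[OF that]])
  qed
qed

lemma bcontfun_susp_eqI:
  fixes g h :: "'x::pointed_topological_space susp \<Rightarrow>\<^sub>C 'a::metric_space"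
  assumes "\<And>p. p \<in> {0..1} \<times> UNIV \<Longrightarrow> apply_bcontfun g (abs_susp p) = apply_bcontfun h (abs_susp p)"
  shows "g = h"
proof (rule bcontfun_eqI)
  fix s :: "'x susp"
  obtain p where "p \<in> {0..1} \<times> UNIV" "s = abs_susp p" using abs_susp_surj by blast
  then show "apply_bcontfun g s = apply_bcontfun h s" using assms by blast
qed

definition susp_lift ::
    "(real \<times> 'x::pointed_topological_space \<Rightarrow> 'a::real_normed_vector) \<Rightarrow> ('x susp \<Rightarrow>\<^sub>C 'a)" where
  "susp_lift F = Bcontfun (\<lambda>s. F (rep_susp s))"

text \<open>Compatibility makes the chosen representative immaterial. Continuity is then the
  definition of the quotient topology, and boundedness follows from compactness of the
  suspension.\<close>

lemma apply_susp_lift: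
  fixes F :: "real \<times> 'x::pointed_topological_space \<Rightarrow> 'a::real_normed_vector"
  assumes X: "compact (UNIV :: 'x set)" and F: "continuous_on ({0..1} \<times> UNIV) F" "susp_compatible F"
    and p: "p \<in> {0..1} \<times> UNIV"
  shows "apply_bcontfun (susp_lift F) (abs_susp p) = F p"
proof -
  have eq: "F (rep_susp (abs_susp q)) = F q" if "q \<in> {0..1} \<times> UNIV" for q
    by (rule susp_compatible_respects[OF F(2) susp_rel_rep_abs[OF that]])
  have "continuous_on UNIV (\<lambda>s. F (rep_susp s))"
    unfolding continuous_on_open_vimage[OF open_UNIV]
  proof (intro allI impI)
    fix U :: "'a set" assume "open U"
    then have "openin (top_of_set ({0..1} \<times> UNIV)) (({0..1} \<times> UNIV) \<inter> F -` U)"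
      using F(1) by (simp add: continuous_openin_preimage_gen)
    also have "({0..1} \<times> UNIV) \<inter> F -` U
        = {p \<in> {0..1} \<times> UNIV. abs_susp p \<in> (\<lambda>s. F (rep_susp s)) -` U \<inter> UNIV}"
      using eq by auto
    finally show "open ((\<lambda>s. F (rep_susp s)) -` U \<inter> UNIV)"
      by (simp only: open_susp_def)
  qed
  then have "(\<lambda>s. F (rep_susp s)) \<in> bcontfun"
    unfolding bcontfun_def
    using compact_imp_bounded[OF compact_continuous_image[OF _ compact_susp[OF X]]] by blast
  then show ?thesis using eq[OF p] by (simp add: susp_lift_def Bcontfun_inverse)
qed

definition eval_mat ::
    "(nat \<Rightarrow> nat \<Rightarrow> ('x::pointed_topological_space susp \<Rightarrow>\<^sub>C 'a::real_normed_vector)) \<Rightarrow> real \<times> 'x \<Rightarrow> nat \<Rightarrow> nat \<Rightarrow> 'a" where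
  "eval_mat G p = (\<lambda>i j. apply_bcontfun (G i j) (abs_susp p))"

definition eval_vec ::
    "(nat \<Rightarrow> ('x::pointed_topological_space susp \<Rightarrow>\<^sub>C 'a::real_normed_vector)) \<Rightarrow> real \<times> 'x \<Rightarrow> nat \<Rightarrow> 'a" where
  "eval_vec v p = (\<lambda>i. apply_bcontfun (v i) (abs_susp p))"

lemma continuous_on_eval_mat: "continuous_on ({0..1} \<times> UNIV) (eval_mat G)"
  unfolding continuous_on_matrix_iff eval_mat_def
  by (intro allI continuous_on_compose2[OF continuous_on_apply_bcontfun[of UNIV] continuous_on_abs_susp]) auto

lemma continuous_on_eval_vec: "continuous_on ({0..1} \<times> UNIV) (eval_vec v)"
  unfolding continuous_on_vector_iff eval_vec_def
  by (intro allI continuous_on_compose2[OF continuous_on_apply_bcontfun[of UNIV] continuous_on_abs_susp]) auto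

lemma susp_compatible_eval: "susp_compatible (eval_mat G)" "susp_compatible (eval_vec v)"
  unfolding eval_mat_def[abs_def] eval_vec_def[abs_def] by (rule susp_compatible_abs_susp)+

lemma eval_mat_mult:
  fixes G H :: "nat \<Rightarrow> nat \<Rightarrow> ('x::pointed_topological_space susp \<Rightarrow>\<^sub>C 'a::{real_normed_algebra,monoid_mult})"
  shows "eval_mat (mat_mult m G H) p = mat_mult m (eval_mat G p) (eval_mat H p)"
  by (simp add: eval_mat_def mat_mult_def apply_bcontfun_sum)

lemma eval_mat_vec:
  fixes G :: "nat \<Rightarrow> nat \<Rightarrow> ('x::pointed_topological_space susp \<Rightarrow>\<^sub>C 'a::{real_normed_algebra,monoid_mult})"
  shows "eval_vec (mat_vec m G v) p = mat_vec m (eval_mat G p) (eval_vec v p)"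
  by (simp add: eval_mat_def eval_vec_def mat_vec_def apply_bcontfun_sum)

lemma eval_id_mat [simp]: "eval_mat (id_mat m) p = id_mat m"
  by (auto simp: eval_mat_def id_mat_def fun_eq_iff)

lemma eval_unit_vec [simp]: "eval_vec (unit_vec k) p = unit_vec k"
  by (auto simp: eval_vec_def unit_vec_def fun_eq_iff)

text \<open>Evaluation at a point is a unital ring homomorphism, so it maps inverses to
  inverses.\<close>

lemma eval_mat_GL:
  fixes G :: "nat \<Rightarrow> nat \<Rightarrow> ('x::pointed_topological_space susp \<Rightarrow>\<^sub>C 'a::{real_normed_algebra,monoid_mult})"
  assumes "G \<in> GL UNIV m"
  shows "eval_mat G p \<in> GL UNIV m"
proof (rule GL_I)
  have "eval_mat H p \<in> mats UNIV m" if "H \<in> mats UNIV m" for H :: "nat \<Rightarrow> nat \<Rightarrow> ('x susp \<Rightarrow>\<^sub>C 'a)"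
    using that by (auto simp: eval_mat_def mats_def)
  then show "eval_mat G p \<in> mats UNIV m" "eval_mat (minv m G) p \<in> mats UNIV m"
    using GL_mats[OF assms] minv_mats[OF assms] by blast+
qed (simp_all add: minv[OF assms] flip: eval_mat_mult)

lemma eval_vec_Lg:
  fixes v :: "nat \<Rightarrow> ('x::pointed_topological_space susp \<Rightarrow>\<^sub>C 'a::{real_normed_algebra,monoid_mult})"
  assumes "v \<in> Lg UNIV m"
  obtains b where "b \<in> vecs UNIV m" "\<And>p. eval_vec v p \<in> vecs UNIV m" "\<And>p. eval_vec b p \<in> vecs UNIV m"
    "\<And>p. (\<Sum>i<m. eval_vec b p i * eval_vec v p i) = 1"
proof -
  obtain b where v: "v \<in> vecs UNIV m" and b: "b \<in> vecs UNIV m" "(\<Sum>i<m. b i * v i) = 1"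
    using assms by (auto simp: Lg_iff)
  show thesis
  proof (rule that[OF b(1)])
    fix p
    show "eval_vec v p \<in> vecs UNIV m" "eval_vec b p \<in> vecs UNIV m"
      using v b by (auto simp: eval_vec_def vecs_def)
    have "(\<Sum>i<m. eval_vec b p i * eval_vec v p i) = apply_bcontfun (\<Sum>i<m. b i * v i) (abs_susp p)"
      by (simp add: eval_vec_def apply_bcontfun_sum)
    then show "(\<Sum>i<m. eval_vec b p i * eval_vec v p i) = 1" by (simp add: b(2))
  qed
qed

lemma eval_mat_eqI: "(\<And>p. p \<in> {0..1} \<times> UNIV \<Longrightarrow> eval_mat G p = eval_mat H p) \<Longrightarrow> G = H"
  by (intro ext bcontfun_susp_eqI) (simp add: eval_mat_def fun_eq_iff)

lemma eval_vec_eqI: "(\<And>p. p \<in> {0..1} \<times> UNIV \<Longrightarrow> eval_vec v p = eval_vec w p) \<Longrightarrow> v = w"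
  by (intro ext bcontfun_susp_eqI) (simp add: eval_vec_def fun_eq_iff)

text \<open>The pointwise inverse of \<open>F\<close> is again continuous and compatible, so it
  lifts too and inverts the lift of \<open>F\<close>.\<close>

lemma GL_susp_lift:
  fixes F :: "real \<times> 'x::pointed_topological_space \<Rightarrow> nat \<Rightarrow> nat \<Rightarrow> 'a::{real_normed_algebra,monoid_mult}"
  assumes X: "compact (UNIV :: 'x set)" and F: "continuous_on ({0..1} \<times> UNIV) F" "susp_compatible F"
    and GL: "\<And>p. p \<in> {0..1} \<times> UNIV \<Longrightarrow> F p \<in> GL UNIV m"
  shows "\<exists>G\<in>GL UNIV m. \<forall>p\<in>{0..1} \<times> UNIV. eval_mat G p = F p"
proof -
  have lift: "\<exists>G\<in>mats UNIV m. \<forall>p\<in>{0..1} \<times> UNIV. eval_mat G p = F p"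
    if F: "continuous_on ({0..1} \<times> UNIV) F" "susp_compatible F"
      and mats: "\<And>p. p \<in> {0..1} \<times> UNIV \<Longrightarrow> F p \<in> mats UNIV m"
    for F :: "real \<times> 'x \<Rightarrow> nat \<Rightarrow> nat \<Rightarrow> 'a"
  proof (intro bexI ballI)
    let ?G = "\<lambda>i j. susp_lift (\<lambda>p. F p i j)"
    have ap: "apply_bcontfun (?G i j) (abs_susp p) = F p i j" if "p \<in> {0..1} \<times> UNIV" for i j p
      using F(1) susp_compatible_compose[OF F(2), of "\<lambda>a. a i j"]
      by (intro apply_susp_lift X that) (auto simp: continuous_on_matrix_iff)
    show "eval_mat ?G p = F p" if "p \<in> {0..1} \<times> UNIV" for p
      using ap[OF that] by (simp add: eval_mat_def)
    have "?G i j = 0" if "\<not> (i < m \<and> j < m)" for i j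
      using mats that by (intro bcontfun_susp_eqI) (auto simp: ap mats_def)
    then show "?G \<in> mats UNIV m" by (auto simp: mats_def)
  qed
  obtain G where G: "G \<in> mats UNIV m" "\<And>p. p \<in> {0..1} \<times> UNIV \<Longrightarrow> eval_mat G p = F p"
    using lift[OF F GL_mats[OF GL]] by blast
  obtain G' where G': "G' \<in> mats UNIV m" "\<And>p. p \<in> {0..1} \<times> UNIV \<Longrightarrow> eval_mat G' p = minv m (F p)"
    using lift[OF continuous_on_minv[OF F(1) GL] susp_compatible_compose[OF F(2), of "minv m"] minv_mats[OF GL]] by blast
  have "G \<in> GL UNIV m"
  proof (rule GL_I[OF G(1) G'(1)])
    show "mat_mult m G G' = id_mat m"
      by (rule eval_mat_eqI) (simp add: eval_mat_mult G G' minv_right[OF GL])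
    show "mat_mult m G' G = id_mat m"
      by (rule eval_mat_eqI) (simp add: eval_mat_mult G G' minv_left[OF GL])
  qed
  with G(2) show ?thesis by blast
qed

text \<open>The coefficients are required to be continuous and compatible themselves, so that the
  identity \<open>b v = 1\<close> descends as a whole.\<close>

lemma Lg_susp_lift:
  fixes v b :: "real \<times> 'x::pointed_topological_space \<Rightarrow> nat \<Rightarrow> 'a::{real_normed_algebra,monoid_mult}"
  assumes X: "compact (UNIV :: 'x set)"
    and v: "continuous_on ({0..1} \<times> UNIV) v" "susp_compatible v" "\<And>p. p \<in> {0..1} \<times> UNIV \<Longrightarrow> v p \<in> vecs UNIV m"
    and b: "continuous_on ({0..1} \<times> UNIV) b" "susp_compatible b" "\<And>p. p \<in> {0..1} \<times> UNIV \<Longrightarrow> b p \<in> vecs UNIV m"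
    and bv: "\<And>p. p \<in> {0..1} \<times> UNIV \<Longrightarrow> (\<Sum>i<m. b p i * v p i) = 1"
  shows "\<exists>V\<in>Lg UNIV m. \<forall>p\<in>{0..1} \<times> UNIV. eval_vec V p = v p"
proof -
  have lift: "\<exists>V\<in>vecs UNIV m. \<forall>p\<in>{0..1} \<times> UNIV. eval_vec V p = v p"
    if v: "continuous_on ({0..1} \<times> UNIV) v" "susp_compatible v"
      and vecs: "\<And>p. p \<in> {0..1} \<times> UNIV \<Longrightarrow> v p \<in> vecs UNIV m"
    for v :: "real \<times> 'x \<Rightarrow> nat \<Rightarrow> 'a"
  proof (intro bexI ballI)
    let ?V = "\<lambda>i. susp_lift (\<lambda>p. v p i)"
    have ap: "apply_bcontfun (?V i) (abs_susp p) = v p i" if "p \<in> {0..1} \<times> UNIV" for i p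
      using v(1) susp_compatible_compose[OF v(2), of "\<lambda>a. a i"]
      by (intro apply_susp_lift X that) (auto simp: continuous_on_vector_iff)
    show "eval_vec ?V p = v p" if "p \<in> {0..1} \<times> UNIV" for p
      using ap[OF that] by (simp add: eval_vec_def)
    have "?V i = 0" if "m \<le> i" for i
      using vecs that by (intro bcontfun_susp_eqI) (auto simp: ap vecs_def)
    then show "?V \<in> vecs UNIV m" by (auto simp: vecs_def)
  qed
  obtain V where V: "V \<in> vecs UNIV m" "\<And>p. p \<in> {0..1} \<times> UNIV \<Longrightarrow> eval_vec V p = v p"
    using lift[OF v] by blast
  obtain B where B: "B \<in> vecs UNIV m" "\<And>p. p \<in> {0..1} \<times> UNIV \<Longrightarrow> eval_vec B p = b p"
    using lift[OF b] by blast
  have "(\<Sum>i<m. B i * V i) = 1"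
  proof (rule bcontfun_susp_eqI)
    fix p :: "real \<times> 'x" assume p: "p \<in> {0..1} \<times> UNIV"
    have "apply_bcontfun (\<Sum>i<m. B i * V i) (abs_susp p) = (\<Sum>i<m. eval_vec B p i * eval_vec V p i)"
      by (simp add: eval_vec_def apply_bcontfun_sum)
    then show "apply_bcontfun (\<Sum>i<m. B i * V i) (abs_susp p) = apply_bcontfun 1 (abs_susp p)"
      using p by (simp add: V B bv)
  qed
  then have "V \<in> Lg UNIV m" using V(1) B(1) by (auto simp: Lg_iff)
  with V(2) show ?thesis by blast
qed


section \<open>Injectivity of the stabilisation maps\<close>

lemma continuous_map_GL_top:
  "continuous_map (top_of_set S) (GL_top k) f \<longleftrightarrow> continuous_on S f \<and> f ` S \<subseteq> GL UNIV k"
  by (auto simp: GL_top_def)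

lemma based_maps_GL_iff:
  "f \<in> based_maps euclidean basepoint (GL_top k) (id_mat k) \<longleftrightarrow>
     continuous_on UNIV f \<and> (\<forall>x. f x \<in> GL UNIV k) \<and> f basepoint = id_mat k"
  using continuous_map_GL_top[of UNIV k f] by (auto simp: based_maps_def)

text \<open>A homotopy thus lives on [0,1] \<times> X, the domain on which matrices over the
  suspension are evaluated, and the two can be multiplied pointwise.\<close>

lemma based_homotopy_GL_iff:
  "(f, g) \<in> based_homotopy_rel euclidean (basepoint :: 'x::pointed_topological_space) (GL_top k) (id_mat k) \<longleftrightarrow>
     (\<exists>H. continuous_on ({0..1::real} \<times> UNIV) H \<and> (\<forall>p\<in>{0..1} \<times> UNIV. H p \<in> GL UNIV k) \<and>
        (\<forall>x. H (0, x) = f x) \<and> (\<forall>x. H (1, x) = g x) \<and> (\<forall>t\<in>{0..1}. H (t, basepoint) = id_mat k))"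
  (is "?L \<longleftrightarrow> ?R")
proof -
  have top: "prod_topology (top_of_set {0..1::real}) euclidean = top_of_set ({0..1} \<times> (UNIV :: 'x set))"
    using prod_topology_subtopology_eu[of "{0..1}" UNIV] by (simp only: subtopology_UNIV)
  have "homotopic_with (\<lambda>h. h basepoint = id_mat k) euclidean (GL_top k) f g \<longleftrightarrow> ?R"
    unfolding homotopic_with_def top continuous_map_GL_top by (simp only: image_subset_iff conj_assoc)
  moreover have "?L \<longleftrightarrow> homotopic_with (\<lambda>h. h basepoint = id_mat k) euclidean (GL_top k) f g"
    by (auto simp: based_homotopy_rel_def based_maps_def dest: homotopic_with_imp_continuous_maps
        homotopic_with_imp_property)
  ultimately show ?thesis by blast
qed

lemma equiv_based_homotopy: "equiv (based_maps X x0 Y y0) (based_homotopy_rel X x0 Y y0)"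
proof (rule equivI)
  show "refl_on (based_maps X x0 Y y0) (based_homotopy_rel X x0 Y y0)"
    by (auto simp: refl_on_def based_homotopy_rel_def based_maps_def)
  show "sym (based_homotopy_rel X x0 Y y0)"
    by (auto simp: sym_def based_homotopy_rel_def intro: homotopic_with_symD)
  show "trans (based_homotopy_rel X x0 Y y0)"
    by (auto simp: trans_def based_homotopy_rel_def intro: homotopic_with_trans)
qed (auto simp: based_homotopy_rel_def)

text \<open>The image of a class under \<open>h\<close> need not be a whole class, but saturating it
  by \<open>s\<close> gives exactly the class of \<open>h a\<close>. Injectivity on classes then
  says that \<open>h\<close> reflects the relation.\<close>

lemma inj_on_quotient_image:
  assumes r: "equiv A r" and s: "equiv B s" and h: "\<And>a. a \<in> A \<Longrightarrow> h a \<in> B"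
    and resp: "\<And>a a'. (a, a') \<in> r \<Longrightarrow> (h a, h a') \<in> s"
  shows "inj_on (\<lambda>c. s `` (h ` c)) (A // r) \<longleftrightarrow> (\<forall>a\<in>A. \<forall>a'\<in>A. (h a, h a') \<in> s \<longrightarrow> (a, a') \<in> r)"
proof -
  have cls: "s `` (h ` (r `` {a})) = s `` {h a}" if "a \<in> A" for a
  proof
    show "s `` {h a} \<subseteq> s `` (h ` (r `` {a}))" using that equiv_class_self[OF r] by blast
    show "s `` (h ` (r `` {a})) \<subseteq> s `` {h a}" using resp s unfolding equiv_def by (blast dest: transD)
  qed
  have "inj_on (\<lambda>c. s `` (h ` c)) (A // r) \<longleftrightarrow>
      (\<forall>a\<in>A. \<forall>a'\<in>A. s `` {h a} = s `` {h a'} \<longrightarrow> r `` {a} = r `` {a'})"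
    by (auto simp: inj_on_def quotient_def cls)
  also have "\<dots> \<longleftrightarrow> (\<forall>a\<in>A. \<forall>a'\<in>A. (h a, h a') \<in> s \<longrightarrow> (a, a') \<in> r)"
    using eq_equiv_class_iff[OF r] eq_equiv_class_iff[OF s] h by simp
  finally show ?thesis .
qed

lemma inj_stab_classes_iff:
  "inj_on (stab_classes k) (GL_classes k :: ('x::pointed_topological_space \<Rightarrow> nat \<Rightarrow> nat \<Rightarrow> 'a::unital_cstar_algebra) set set)
    \<longleftrightarrow> (\<forall>f\<in>based_maps euclidean (basepoint :: 'x) (GL_top k) (id_mat k :: nat \<Rightarrow> nat \<Rightarrow> 'a).
          \<forall>g\<in>based_maps euclidean basepoint (GL_top k) (id_mat k).
          (stab k \<circ> f, stab k \<circ> g) \<in> based_homotopy_rel euclidean basepoint (GL_top (Suc k)) (id_mat (Suc k))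
          \<longrightarrow> (f, g) \<in> based_homotopy_rel euclidean basepoint (GL_top k) (id_mat k))"
  unfolding GL_classes_def based_classes_def stab_classes_def[abs_def]
proof (rule inj_on_quotient_image[OF equiv_based_homotopy equiv_based_homotopy])
  fix f :: "'x \<Rightarrow> nat \<Rightarrow> nat \<Rightarrow> 'a"
  assume "f \<in> based_maps euclidean basepoint (GL_top k) (id_mat k)"
  then show "stab k \<circ> f \<in> based_maps euclidean basepoint (GL_top (Suc k)) (id_mat (Suc k))"
    using continuous_on_stab[of UNIV f k] by (auto simp: based_maps_GL_iff stab_GL o_def)
next
  fix f g :: "'x \<Rightarrow> nat \<Rightarrow> nat \<Rightarrow> 'a"
  assume "(f, g) \<in> based_homotopy_rel euclidean basepoint (GL_top k) (id_mat k)"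
  then obtain H where "continuous_on ({0..1::real} \<times> UNIV) H" "\<forall>p\<in>{0..1} \<times> UNIV. H p \<in> GL UNIV k"
    "\<forall>x. H (0, x) = f x" "\<forall>x. H (1, x) = g x" "\<forall>t\<in>{0..1}. H (t, basepoint) = id_mat k"
    by (auto simp: based_homotopy_GL_iff)
  then show "(stab k \<circ> f, stab k \<circ> g) \<in> based_homotopy_rel euclidean basepoint (GL_top (Suc k)) (id_mat (Suc k))"
    unfolding based_homotopy_GL_iff
    by (intro exI[of _ "\<lambda>p. stab k (H p)"]) (auto intro: continuous_on_stab stab_GL)
qed


section \<open>Transitivity over the suspension\<close>

text \<open>Row k of the inverse will serve as the coefficient row for the last column of a
  homotopy. Being a unit vector at both stabilised ends, it is constant there, as a function on the
  suspension must be.\<close>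

lemma minv_stab_row:
  fixes a :: "nat \<Rightarrow> nat \<Rightarrow> 'a::{ring,monoid_mult}"
  assumes "a \<in> GL UNIV k"
  shows "minv (Suc k) (stab k a) k = unit_vec k"
proof -
  have "minv (Suc k) (stab k a) = stab k (minv k a)"
    using GL_mats[OF assms] minv[OF assms]
    by (intro minv_eqI stab_GL[OF assms]) (simp_all add: stab_mats stab_mult)
  then show ?thesis
    using minv_mats[OF assms] by (auto simp: stab_def unit_vec_def mats_def)
qed

text \<open>The last column of a homotopy between two stabilised maps is a unimodular vector over the
  algebra of the suspension. Completing it to an invertible matrix \<open>G\<close> and dividing by \<open>G\<close> leaves a
  homotopy with last column \<open>e\<^sub>k\<close>, whose upper left corner connects the original maps.\<close>

lemma homotopic_of_GL_transitive_susp: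
  fixes f g :: "'x::pointed_topological_space \<Rightarrow> nat \<Rightarrow> nat \<Rightarrow> 'a::unital_cstar_algebra"
  assumes X: "compact (UNIV :: 'x set)"
    and trans: "GL_transitive (UNIV :: ('x susp \<Rightarrow>\<^sub>C 'a) set) (Suc k)"
    and f: "f \<in> based_maps euclidean basepoint (GL_top k) (id_mat k)"
    and g: "g \<in> based_maps euclidean basepoint (GL_top k) (id_mat k)"
    and hom: "(stab k \<circ> f, stab k \<circ> g)
      \<in> based_homotopy_rel euclidean basepoint (GL_top (Suc k)) (id_mat (Suc k))"
  shows "(f, g) \<in> based_homotopy_rel euclidean basepoint (GL_top k) (id_mat k)"
proof -
  let ?D = "{0..1::real} \<times> (UNIV :: 'x set)" and ?m = "Suc k"
  have fg: "f x \<in> GL UNIV k" "g x \<in> GL UNIV k" for x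
    using f g by (auto simp: based_maps_GL_iff)
  note fgm = fg[THEN GL_mats]
  obtain H where H: "continuous_on ?D H" "\<And>p. p \<in> ?D \<Longrightarrow> H p \<in> GL UNIV ?m"
    and H0: "\<And>x. H (0, x) = stab k (f x)" and H1: "\<And>x. H (1, x) = stab k (g x)"
    and Hb: "\<And>t. t \<in> {0..1} \<Longrightarrow> H (t, basepoint) = id_mat ?m"
    using hom unfolding based_homotopy_GL_iff o_def by blast
  define v where "v p = mat_vec ?m (H p) (unit_vec k)" for p
  define b where "b p = minv ?m (H p) k" for p
  have v0: "v (0, x) = unit_vec k" and v1: "v (1, x) = unit_vec k" for x
    using fgm by (simp_all add: v_def H0 H1 stab_column)
  have vb: "v (t, basepoint) = unit_vec k" if "t \<in> {0..1}" for t
    using Hb[OF that] by (simp add: v_def)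
  have b0: "b (0, x) = unit_vec k" and b1: "b (1, x) = unit_vec k" for x
    using fg by (simp_all add: b_def H0 H1 minv_stab_row)
  have bb: "b (t, basepoint) = unit_vec k" if "t \<in> {0..1}" for t
  proof -
    have "b (t, basepoint) = id_mat ?m k" by (simp only: b_def Hb[OF that] minv_id)
    then show ?thesis by (simp add: id_mat_def unit_vec_def fun_eq_iff)
  qed
  have "continuous_on ?D v"
    unfolding v_def by (intro continuous_on_mat_vec H continuous_on_const)
  moreover have "susp_compatible v" by (rule susp_compatibleI[OF v0 v1 vb])
  moreover have "v p \<in> vecs UNIV ?m" if "p \<in> ?D" for p
    unfolding v_def using GL_mats[OF H(2)[OF that]] by blast
  moreover have "continuous_on ?D b"
    using continuous_on_minv[OF H] unfolding b_def continuous_on_matrix_iff continuous_on_vector_iff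
    by blast
  moreover have "susp_compatible b" by (rule susp_compatibleI[OF b0 b1 bb])
  moreover have "b p \<in> vecs UNIV ?m" if "p \<in> ?D" for p
    unfolding b_def using minv_mats[OF H(2)[OF that]] by (auto simp: mats_def vecs_def)
  moreover have "(\<Sum>i<?m. b p i * v p i) = 1" if "p \<in> ?D" for p
  proof -
    have "(\<Sum>i<?m. b p i * v p i) = mat_mult ?m (minv ?m (H p)) (H p) k k"
      by (simp only: b_def v_def mat_vec_unit[OF lessI] mat_mult_def)
    then show ?thesis by (simp only: minv_left[OF H(2)[OF that]] id_mat_def) simp
  qed
  ultimately obtain V where V: "V \<in> Lg UNIV ?m" "\<And>p. p \<in> ?D \<Longrightarrow> eval_vec V p = v p"
    using Lg_susp_lift[OF X, of v ?m b] by blast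
  obtain G where G: "G \<in> GL UNIV ?m" "mat_vec ?m G (unit_vec k) = V"
    using trans V(1) unfolding GL_transitive_iff[OF lessI] by blast
  define \<Gamma> where "\<Gamma> = eval_mat G"
  have \<Gamma>_GL: "\<Gamma> p \<in> GL UNIV ?m" for p unfolding \<Gamma>_def by (rule eval_mat_GL[OF G(1)])
  have \<Gamma>_cont: "continuous_on ?D \<Gamma>" unfolding \<Gamma>_def by (rule continuous_on_eval_mat)
  have \<Gamma>_comp: "susp_compatible \<Gamma>" unfolding \<Gamma>_def by (rule susp_compatible_eval)
  have \<Gamma>_v: "mat_vec ?m (\<Gamma> p) (unit_vec k) = v p" if "p \<in> ?D" for p
    using eval_mat_vec[of ?m G "unit_vec k" p] V(2)[OF that] by (simp add: G(2) \<Gamma>_def)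
  define \<gamma> where "\<gamma> = \<Gamma> (0, basepoint)"
  \<comment> \<open>The constant factor \<open>\<gamma>\<close> makes \<open>K\<close> agree with
    \<open>H\<close> at both ends and over the base point, where \<open>\<Gamma>\<close> equals
    \<open>\<gamma>\<close>. It fixes \<open>unit_vec k\<close>, so the last column of
    \<open>K\<close> is still that vector.\<close>
  define K where "K p = mat_mult ?m (mat_mult ?m \<gamma> (minv ?m (\<Gamma> p))) (H p)" for p
  have K_eq: "K p = H p" if "p \<in> ?D" "\<Gamma> p = \<gamma>" for p
  proof -
    have "mat_mult ?m \<gamma> (minv ?m (\<Gamma> p)) = id_mat ?m"
      unfolding that(2) \<gamma>_def by (rule minv_right[OF \<Gamma>_GL])
    then show ?thesis by (simp add: K_def GL_mats[OF H(2)[OF that(1)]])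
  qed
  have K_GL: "K p \<in> GL UNIV ?m" if "p \<in> ?D" for p
    unfolding K_def \<gamma>_def by (intro GL_mult minv_GL \<Gamma>_GL H(2) that)
  have K_unit: "mat_vec ?m (K p) (unit_vec k) = unit_vec k" if "p \<in> ?D" for p
  proof -
    have "mat_vec ?m (minv ?m (\<Gamma> p)) (v p) = unit_vec k"
      unfolding \<Gamma>_v[OF that, symmetric] by (rule mat_vec_minv[OF \<Gamma>_GL unit_vec_vecs[OF lessI]])
    then show ?thesis
      using \<Gamma>_v[of "(0, basepoint)"] by (simp add: K_def mat_vec_mult v0 \<gamma>_def flip: v_def)
  qed
  have K_cont: "continuous_on ?D K"
    unfolding K_def using continuous_on_minv[OF \<Gamma>_cont \<Gamma>_GL]
    by (intro continuous_on_mat_mult continuous_on_const H(1))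
  show ?thesis
    unfolding based_homotopy_GL_iff
  proof (intro exI conjI allI ballI)
    show "continuous_on ?D (\<lambda>p. corner k (K p))" by (rule continuous_on_corner[OF K_cont])
    show "corner k (K p) \<in> GL UNIV k" if "p \<in> ?D" for p
      using that by (intro corner_GL K_GL K_unit)
    show "corner k (K (0, x)) = f x" for x
      using K_eq[of "(0, x)"] susp_compatibleD(1)[OF \<Gamma>_comp, of x] fgm
      by (simp add: \<gamma>_def H0 corner_stab)
    show "corner k (K (1, x)) = g x" for x
      using K_eq[of "(1, x)"] susp_compatibleD(2)[OF \<Gamma>_comp, of x] fgm
      by (simp add: \<gamma>_def H1 corner_stab)
    show "corner k (K (t, basepoint)) = id_mat k" if "t \<in> {0..1}" for t
      using K_eq[of "(t, basepoint)"] susp_compatibleD(3)[OF \<Gamma>_comp that] that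
      by (simp add: \<gamma>_def Hb)
  qed
qed

text \<open>Constant functions embed A into the algebra of the suspension, and evaluation at the
  base point is a retraction: complete the constant vector to a matrix there, then evaluate.\<close>

lemma GL_transitive_of_susp:
  assumes X: "compact (UNIV :: 'x::pointed_topological_space set)"
    and trans: "GL_transitive (UNIV :: ('x susp \<Rightarrow>\<^sub>C 'a::unital_cstar_algebra) set) (Suc k)"
  shows "GL_transitive (UNIV :: 'a set) (Suc k)"
  unfolding GL_transitive_iff[OF lessI]
proof
  fix v :: "nat \<Rightarrow> 'a" assume "v \<in> Lg UNIV (Suc k)"
  then obtain b where "v \<in> vecs UNIV (Suc k)" "b \<in> vecs UNIV (Suc k)" "(\<Sum>i<Suc k. b i * v i) = 1"
    unfolding Lg_iff by blast
  then obtain V :: "nat \<Rightarrow> ('x susp \<Rightarrow>\<^sub>C 'a)" where V: "V \<in> Lg UNIV (Suc k)"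
    "\<And>p. p \<in> {0..1} \<times> UNIV \<Longrightarrow> eval_vec V p = v"
    using Lg_susp_lift[OF X, of "\<lambda>_. v" "Suc k" "\<lambda>_. b"] by (auto simp: susp_compatible_def)
  obtain G where G: "G \<in> GL UNIV (Suc k)" "mat_vec (Suc k) G (unit_vec k) = V"
    using trans V(1) unfolding GL_transitive_iff[OF lessI] by blast
  have "mat_vec (Suc k) (eval_mat G (0, basepoint)) (unit_vec k) = v"
    using eval_mat_vec[of "Suc k" G "unit_vec k" "(0, basepoint)"] V(2)[of "(0, basepoint)"]
    by (simp add: G(2))
  then show "\<exists>g\<in>GL UNIV (Suc k). mat_vec (Suc k) g (unit_vec k) = v"
    using eval_mat_GL[OF G(1)] by blast
qed

text \<open>Lift the loop \<open>V\<close> of unimodular vectors to a path of invertible matrices starting at the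
  identity. Its end can be arranged to be a stabilised map \<open>stab k \<circ> f\<close>, which is null-homotopic
  through the path itself; by injectivity so is \<open>f\<close>, and correcting the path by that homotopy closes it
  up without changing its last column.\<close>

lemma complete_based_unimodular:
  fixes V :: "nat \<Rightarrow> ('x::pointed_topological_space susp \<Rightarrow>\<^sub>C 'a::unital_cstar_algebra)"
  assumes X: "compact (UNIV :: 'x set)"
    and inj: "\<And>f. f \<in> based_maps euclidean basepoint (GL_top k) (id_mat k) \<Longrightarrow>
      (stab k \<circ> (\<lambda>_. id_mat k), stab k \<circ> f)
        \<in> based_homotopy_rel euclidean (basepoint :: 'x) (GL_top (Suc k)) (id_mat (Suc k) :: nat \<Rightarrow> nat \<Rightarrow> 'a) \<Longrightarrow>
      (\<lambda>_. id_mat k, f) \<in> based_homotopy_rel euclidean (basepoint :: 'x) (GL_top k) (id_mat k)"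
    and V: "V \<in> Lg UNIV (Suc k)" and Vb: "eval_vec V (0, basepoint) = unit_vec k"
  shows "\<exists>G\<in>GL UNIV (Suc k). mat_vec (Suc k) G (unit_vec k) = V"
proof -
  let ?D = "{0..1::real} \<times> (UNIV :: 'x set)" and ?m = "Suc k"
  obtain b where vecs: "\<And>p. eval_vec V p \<in> vecs UNIV ?m" and b: "\<And>p. eval_vec b p \<in> vecs UNIV ?m"
    and bV: "\<And>p. (\<Sum>i<?m. eval_vec b p i * eval_vec V p i) = 1"
    by (rule eval_vec_Lg[OF V]) (rule that)
  define v where "v = eval_vec V"
  note v = vecs[folded v_def] and bv = bV[folded v_def]
  have comp: "susp_compatible v" unfolding v_def by (rule susp_compatible_eval)
  have v0: "v (0, x) = unit_vec k" and v1: "v (1, x) = unit_vec k" for x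
    using susp_compatibleD(1,2)[OF comp, of x] Vb by (simp_all add: v_def)
  have vb: "v (t, basepoint) = unit_vec k" if "t \<in> {0..1}" for t
    using susp_compatibleD(3)[OF comp that] Vb by (simp add: v_def)
  have v_cont: "continuous_on ?D v" unfolding v_def by (rule continuous_on_eval_vec)
  obtain L where L1: "continuous_on ?D L" and L2: "\<forall>p\<in>?D. L p \<in> GL UNIV ?m"
    and L0: "\<forall>x. L (0, x) = id_mat ?m"
    and Lv: "\<forall>t\<in>{0..1}. \<forall>x. mat_vec ?m (L (t, x)) (v (0, x)) = v (t, x)"
    using homotopy_lifting[of v ?m "eval_vec b", OF X v_cont v continuous_on_eval_vec b bv]
    by (elim exE conjE)
  note L = L1 L2[rule_format] and L0 = L0[rule_format] and Lv = Lv[rule_format, unfolded v0]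
  \<comment> \<open>Dividing by the value over the base point makes the lift based. The last column
    survives because \<open>L\<close> fixes \<open>unit_vec k\<close> over the base point.\<close>
  define H where "H p = mat_mult ?m (L p) (minv ?m (L (fst p, basepoint)))" for p
  have Lb: "L (fst p, basepoint) \<in> GL UNIV ?m" if "p \<in> ?D" for p using that by (auto intro: L(2))
  have H_cont: "continuous_on ?D H"
    unfolding H_def
  proof (intro continuous_on_mat_mult L(1) continuous_on_minv Lb)
    show "continuous_on ?D (\<lambda>p. L (fst p, basepoint))"
      by (rule continuous_on_compose2[OF L(1)]) (auto intro!: continuous_intros)
  qed
  have H_GL: "H p \<in> GL UNIV ?m" if "p \<in> ?D" for p
    unfolding H_def by (intro GL_mult minv_GL L(2) Lb that)
  have H0: "H (0, x) = id_mat ?m" for x by (simp add: H_def L0)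
  have Hb: "H (t, basepoint) = id_mat ?m" if "t \<in> {0..1}" for t
    using Lb[of "(t, basepoint)"] that by (simp add: H_def minv_right)
  have Hv: "mat_vec ?m (H (t, x)) (unit_vec k) = v (t, x)" if "t \<in> {0..1}" for t x
  proof -
    have "mat_vec ?m (minv ?m (L (t, basepoint))) (mat_vec ?m (L (t, basepoint)) (unit_vec k)) = unit_vec k"
      using that by (intro mat_vec_minv L(2)) auto
    then show ?thesis using that by (simp add: H_def mat_vec_mult Lv vb)
  qed
  \<comment> \<open>\<open>r\<close> is what keeps the end \<open>H (1, x)\<close> from being a
    stabilised matrix. The factor \<open>fst p\<close> in \<open>T\<close> removes it gradually,
    nothing at time 0 and all of it at time 1.\<close>
  define r where "r x = bottom_row k (H (1, x))" for x
  define T where "T p = transvection ?m (unit_vec k) (\<lambda>j. - (fst p *\<^sub>R r (snd p) j))" for p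
  have H1_cont: "continuous_on UNIV (\<lambda>x. H (1, x))"
    by (rule continuous_on_compose2[OF H_cont]) (auto intro!: continuous_intros)
  then have r_cont: "continuous_on UNIV (\<lambda>x. r x j)" for j
    unfolding r_def bottom_row_def continuous_on_matrix_iff by (cases "j < k") simp_all
  have T_cont: "continuous_on ?D T"
    unfolding T_def
  proof (intro continuous_on_transvection continuous_on_const)
    have "continuous_on ?D (\<lambda>p. r (snd p) j)" for j
      by (rule continuous_on_compose2[OF r_cont]) (auto intro!: continuous_intros)
    then show "continuous_on ?D (\<lambda>p j. - (fst p *\<^sub>R r (snd p) j))"
      unfolding continuous_on_vector_iff by (auto intro!: continuous_intros)
  qed
  have row: "(\<lambda>j. - (t *\<^sub>R r x j)) \<in> vecs UNIV ?m" "- (t *\<^sub>R r x k) = 0" for t x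
    by (auto simp: r_def bottom_row_def vecs_def)
  define M where "M p = mat_mult ?m (H p) (T p)" for p
  have M_cont: "continuous_on ?D M" unfolding M_def by (intro continuous_on_mat_mult H_cont T_cont)
  have M_GL: "M p \<in> GL UNIV ?m" if "p \<in> ?D" for p
    unfolding M_def T_def by (intro GL_mult H_GL that row_transvection_GL row)
  have Mv: "mat_vec ?m (M (t, x)) (unit_vec k) = v (t, x)" if "t \<in> {0..1}" for t x
    using that by (simp only: M_def T_def mat_vec_mult row_transvection_column[OF row] Hv)
  define f where "f x = corner k (H (1, x))" for x
  have H1_unit: "mat_vec ?m (H (1, x)) (unit_vec k) = unit_vec k" for x by (simp add: Hv v1)
  have M0: "M (0, x) = id_mat ?m" for x by (simp add: M_def H0 T_def)
  have M1: "M (1, x) = stab k (f x)" for x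
    using clear_bottom_row[OF GL_mats[OF H_GL] H1_unit, of x] by (simp add: M_def T_def f_def r_def)
  have Mb: "M (t, basepoint) = id_mat ?m" if "t \<in> {0..1}" for t
  proof -
    \<comment> \<open>The identity matrix has nothing to clear, so the correction is trivial over
      the base point and the homotopy stays based.\<close>
    have "r basepoint j = 0" for j using Hb[of 1] by (simp add: r_def bottom_row_def id_mat_def)
    then show ?thesis by (simp add: M_def Hb[OF that] T_def)
  qed
  have f: "f \<in> based_maps euclidean basepoint (GL_top k) (id_mat k)"
    unfolding based_maps_GL_iff f_def
    using continuous_on_corner[OF H1_cont] Hb[of 1] by (auto intro!: corner_GL H_GL H1_unit)
  have "(stab k \<circ> (\<lambda>_. id_mat k), stab k \<circ> f) \<in> based_homotopy_rel euclidean basepoint (GL_top ?m) (id_mat ?m)"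
    unfolding based_homotopy_GL_iff
  proof (intro exI[of _ M] conjI ballI allI)
    show "M (0, x) = (stab k \<circ> (\<lambda>_. id_mat k)) x" for x by (simp add: M0)
    show "M (1, x) = (stab k \<circ> f) x" for x by (simp add: M1)
  qed (fact M_cont M_GL Mb)+
  from inj[OF f this] obtain K where K: "continuous_on ?D K" "\<And>p. p \<in> ?D \<Longrightarrow> K p \<in> GL UNIV k"
    and K0: "\<And>x. K (0, x) = id_mat k" and K1: "\<And>x. K (1, x) = f x"
    and Kb: "\<And>t. t \<in> {0..1} \<Longrightarrow> K (t, basepoint) = id_mat k"
    unfolding based_homotopy_GL_iff by blast
  \<comment> \<open>At time 1 the factors are \<open>stab k (f x)\<close> and its inverse, so
    \<open>F\<close> returns to the identity; stabilised matrices fix \<open>unit_vec k\<close>, so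
    \<open>F\<close> has the same last column as \<open>M\<close>.\<close>
  define F where "F p = mat_mult ?m (M p) (minv ?m (stab k (K p)))" for p
  have F_GL: "F p \<in> GL UNIV ?m" if "p \<in> ?D" for p
    unfolding F_def by (intro GL_mult minv_GL stab_GL K(2) M_GL that)
  have F_cont: "continuous_on ?D F"
    unfolding F_def by (intro continuous_on_mat_mult M_cont continuous_on_minv continuous_on_stab K(1) stab_GL K(2))
  have F_comp: "susp_compatible F"
  proof (rule susp_compatibleI)
    show "F (0, x) = id_mat ?m" for x by (simp add: F_def M0 K0)
    show "F (1, x) = id_mat ?m" for x
      unfolding F_def M1 K1 using K(2)[of "(1, x)"] by (intro minv_right stab_GL) (simp add: K1)
    show "F (t, basepoint) = id_mat ?m" if "t \<in> {0..1}" for t by (simp add: F_def Mb[OF that] Kb[OF that])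
  qed
  obtain G where G: "G \<in> GL UNIV ?m" "\<And>p. p \<in> ?D \<Longrightarrow> eval_mat G p = F p"
    using GL_susp_lift[OF X F_cont F_comp F_GL] by meson
  have "mat_vec ?m G (unit_vec k) = V"
  proof (rule eval_vec_eqI)
    fix p :: "real \<times> 'x" assume p: "p \<in> ?D"
    have "mat_vec ?m (minv ?m (stab k (K p))) (unit_vec k) = unit_vec k"
      using mat_vec_minv[OF stab_GL[OF K(2)[OF p]] unit_vec_vecs[OF lessI]]
      by (simp only: stab_column[OF GL_mats[OF K(2)[OF p]]])
    then have "mat_vec ?m (F p) (unit_vec k) = v p"
      using p Mv[of "fst p" "snd p"] by (auto simp: F_def mat_vec_mult)
    then show "eval_vec (mat_vec ?m G (unit_vec k)) p = eval_vec V p"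
      by (simp add: eval_mat_vec G(2)[OF p] v_def)
  qed
  with G(1) show ?thesis by blast
qed

lemma GL_susp_const:
  assumes "compact (UNIV :: 'x::pointed_topological_space set)"
    and "(g :: nat \<Rightarrow> nat \<Rightarrow> 'a::{real_normed_algebra,monoid_mult}) \<in> GL UNIV m"
  shows "\<exists>G\<in>GL (UNIV :: ('x susp \<Rightarrow>\<^sub>C 'a) set) m. \<forall>p\<in>{0..1} \<times> UNIV. eval_mat G p = g"
proof -
  have "susp_compatible (\<lambda>_ :: real \<times> 'x. g)" by (simp add: susp_compatible_def)
  from GL_susp_lift[of "\<lambda>_. g", OF assms(1) continuous_on_const this assms(2)] show ?thesis .
qed

lemma GL_transitive_susp_iff:
  assumes X: "compact (UNIV :: 'x::pointed_topological_space set)"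
  shows "GL_transitive (UNIV :: ('x susp \<Rightarrow>\<^sub>C 'a::unital_cstar_algebra) set) (Suc k) \<longleftrightarrow>
    GL_transitive (UNIV :: 'a set) (Suc k) \<and>
    inj_on (stab_classes k) (GL_classes k :: ('x \<Rightarrow> nat \<Rightarrow> nat \<Rightarrow> 'a) set set)"
proof (intro iffI conjI; (elim conjE)?)
  assume trans: "GL_transitive (UNIV :: ('x susp \<Rightarrow>\<^sub>C 'a) set) (Suc k)"
  show "GL_transitive (UNIV :: 'a set) (Suc k)" by (rule GL_transitive_of_susp[OF X trans])
  show "inj_on (stab_classes k) (GL_classes k :: ('x \<Rightarrow> nat \<Rightarrow> nat \<Rightarrow> 'a) set set)"
    unfolding inj_stab_classes_iff
    by (intro ballI impI) (rule homotopic_of_GL_transitive_susp[OF X trans])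
next
  assume trans: "GL_transitive (UNIV :: 'a set) (Suc k)"
    and inj: "inj_on (stab_classes k) (GL_classes k :: ('x \<Rightarrow> nat \<Rightarrow> nat \<Rightarrow> 'a) set set)"
  have const: "(\<lambda>_. id_mat k) \<in> based_maps euclidean (basepoint :: 'x) (GL_top k) (id_mat k :: nat \<Rightarrow> nat \<Rightarrow> 'a)"
    by (simp add: based_maps_GL_iff)
  \<comment> \<open>Injectivity with the constant map as first argument: a map that becomes
    null-homotopic after stabilisation is null-homotopic already.\<close>
  note inj' = inj[unfolded inj_stab_classes_iff, rule_format, OF const]
  show "GL_transitive (UNIV :: ('x susp \<Rightarrow>\<^sub>C 'a) set) (Suc k)"
    unfolding GL_transitive_iff[OF lessI]
  proof
    fix V :: "nat \<Rightarrow> ('x susp \<Rightarrow>\<^sub>C 'a)" assume V: "V \<in> Lg UNIV (Suc k)"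
    have "eval_vec V (0, basepoint) \<in> Lg UNIV (Suc k)"
    proof (rule eval_vec_Lg[OF V])
      fix b
      assume "\<And>p. eval_vec V p \<in> vecs UNIV (Suc k)" "\<And>p. eval_vec b p \<in> vecs UNIV (Suc k)"
        "\<And>p. (\<Sum>i<Suc k. eval_vec b p i * eval_vec V p i) = 1"
      then show ?thesis unfolding Lg_iff by (intro conjI bexI)
    qed
    \<comment> \<open>Transitivity over A supplies the value of \<open>V\<close> at the base point
      as a column of \<open>g\<close>. Dividing \<open>V\<close> by the constant matrix
      \<open>g\<close> leaves a vector \<open>?W\<close> with value \<open>unit_vec k\<close>
      there.\<close>
    then obtain g where g: "g \<in> GL UNIV (Suc k)" "mat_vec (Suc k) g (unit_vec k) = eval_vec V (0, basepoint)"
      using trans unfolding GL_transitive_iff[OF lessI] by blast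
    obtain G where G: "G \<in> GL (UNIV :: ('x susp \<Rightarrow>\<^sub>C 'a) set) (Suc k)"
      and G_eval: "\<forall>p\<in>{0..1} \<times> UNIV. eval_mat G p = g"
      using GL_susp_const[OF X g(1)] by (elim bexE)
    let ?W = "mat_vec (Suc k) (minv (Suc k) G) V"
    have V': "mat_vec (Suc k) G ?W = V"
      by (rule mat_vec_minv'[OF G V[unfolded Lg_iff, THEN conjunct1]])
    have W: "?W \<in> Lg UNIV (Suc k)" by (rule Lg_mat_vec[OF V minv_GL[OF G]])
    have W_vecs: "eval_vec ?W (0, basepoint) \<in> vecs UNIV (Suc k)"
      by (rule eval_vec_Lg[OF W])
    have "mat_vec (Suc k) g (eval_vec ?W (0, basepoint)) = eval_vec (mat_vec (Suc k) G ?W) (0, basepoint)"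
      using G_eval by (simp add: eval_mat_vec)
    also have "\<dots> = mat_vec (Suc k) g (unit_vec k)"
      by (simp only: V' g(2))
    finally have "mat_vec (Suc k) (minv (Suc k) g) (mat_vec (Suc k) g (eval_vec ?W (0, basepoint)))
        = mat_vec (Suc k) (minv (Suc k) g) (mat_vec (Suc k) g (unit_vec k))"
      by (rule arg_cong)
    then have "eval_vec ?W (0, basepoint) = unit_vec k"
      by (simp only: mat_vec_minv[OF g(1) W_vecs] mat_vec_minv[OF g(1) unit_vec_vecs[OF lessI]])
    from complete_based_unimodular[OF X inj' W this]
    obtain F where F: "F \<in> GL UNIV (Suc k)" "mat_vec (Suc k) F (unit_vec k) = ?W"
      by blast
    have "mat_vec (Suc k) (mat_mult (Suc k) G F) (unit_vec k) = V"
      by (simp only: mat_vec_mult F(2) V')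
    then show "\<exists>G\<in>GL UNIV (Suc k). mat_vec (Suc k) G (unit_vec k) = V"
      using GL_mult[OF G F(1)] by blast
  qed
qed

text \<open>Sets of thresholds are closed upwards, so the least element of the intersection of two
  nonempty ones is the larger of their least elements. If one is empty, its infimum is infinite and
  so is the maximum.\<close>

lemma Inf_enat_threshold_conj:
  assumes "\<And>m. m \<ge> 1 \<Longrightarrow> R m \<longleftrightarrow> P m \<and> Q m"
  shows "Inf {enat n | n. n \<ge> 1 \<and> (\<forall>m\<ge>n. R m)} =
     max (Inf {enat n | n. n \<ge> 1 \<and> (\<forall>m\<ge>n. P m)}) (Inf {enat n | n. n \<ge> 1 \<and> (\<forall>m\<ge>n. Q m)})"
  (is "Inf ?C = max (Inf ?A) (Inf ?B)")
proof (rule antisym)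
  have C: "x \<in> ?C \<longleftrightarrow> x \<in> ?A \<and> x \<in> ?B" for x
  proof -
    have "R m \<longleftrightarrow> P m \<and> Q m" if "n \<ge> 1" "m \<ge> n" for m n
      using assms[of m] that by simp
    then have eq: "n \<ge> 1 \<and> (\<forall>m\<ge>n. R m) \<longleftrightarrow> (n \<ge> 1 \<and> (\<forall>m\<ge>n. P m)) \<and> n \<ge> 1 \<and> (\<forall>m\<ge>n. Q m)" for n
      by blast
    have mem: "enat n \<in> {enat n | n. T n} \<longleftrightarrow> T n" for n and T :: "nat \<Rightarrow> bool"
      by blast
    show ?thesis
    proof (cases x)
      case (enat n)
      show ?thesis unfolding enat mem by (rule eq)
    qed simp
  qed
  have least: "\<exists>n. Inf S = enat n \<and> enat n \<in> S" if "S = {enat n | n. T n}" "S \<noteq> {}" for S T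
  proof -
    have "Inf S \<in> S" unfolding Inf_enat_def using that(2) LeastI_ex[of "\<lambda>x. x \<in> S"] by auto
    then show ?thesis using that(1) by auto
  qed
  show "max (Inf ?A) (Inf ?B) \<le> Inf ?C" proof (rule max.boundedI)
    show "Inf ?A \<le> Inf ?C" using C by (intro Inf_superset_mono subsetI) blast
    show "Inf ?B \<le> Inf ?C" using C by (intro Inf_superset_mono subsetI) blast
  qed
  show "Inf ?C \<le> max (Inf ?A) (Inf ?B)"
  proof (cases "?A = {} \<or> ?B = {}")
    case True
    then have "Inf ?A = \<infinity> \<or> Inf ?B = \<infinity>" by (elim disjE) (simp_all only: Inf_empty top_enat_def simp_thms)
    then show ?thesis by (auto simp: max_def)
  next
    case False
    obtain a where a: "Inf ?A = enat a" "enat a \<in> ?A" using least[of ?A, OF refl] False by blast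
    obtain b where b: "Inf ?B = enat b" "enat b \<in> ?B" using least[of ?B, OF refl] False by blast
    have "enat (max a b) \<in> ?C" unfolding C using a(2) b(2) by auto
    then have "Inf ?C \<le> enat (max a b)" by (rule Inf_lower)
    then show ?thesis unfolding a(1) b(1) by (simp add: max_def split: if_splits)
  qed
qed

theorem theorem0p2:
  assumes "compact (UNIV :: 'x::{pointed_topological_space,t2_space} set)"
  shows "gsr (C_tensor :: ('x susp \<Rightarrow>\<^sub>C 'a::unital_cstar_algebra) set) =
         max (gsr (UNIV :: 'a set)) (inj_rank TYPE('x) TYPE('a))"
proof -
  let ?P = "\<lambda>m. GL_transitive (UNIV :: 'a set) m"
  let ?Q = "\<lambda>m. inj_on (stab_classes (m - 1)) (GL_classes (m - 1) :: ('x \<Rightarrow> nat \<Rightarrow> nat \<Rightarrow> 'a) set set)"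
  let ?R = "\<lambda>m. GL_transitive (UNIV :: ('x susp \<Rightarrow>\<^sub>C 'a) set) m"
  have gsr: "gsr S = Inf {enat n | n. n \<ge> 1 \<and> (\<forall>m\<ge>n. GL_transitive S m)}"
    for S :: "'b::{ring,monoid_mult} set"
    unfolding gsr_def GL_transitive_def by (rule refl)
  \<comment> \<open>For \<open>m \<ge> 1\<close> the subtraction \<open>m - 1\<close> is not
    truncated; \<open>m = 1\<close> involves the one-point group of 0 by 0 matrices, where
    injectivity is trivial.\<close>
  have "?R m \<longleftrightarrow> ?P m \<and> ?Q m" if "m \<ge> 1" for m
    using GL_transitive_susp_iff[OF assms, of "m - 1"] that by simp
  from Inf_enat_threshold_conj[of ?R ?P ?Q, OF this] show ?thesis
    unfolding C_tensor_UNIV[OF compact_susp[OF assms]] gsr inj_rank_def .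
qed

end
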